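(* Let $\mathcal{K}$ be the Koopman operator of a measure-preserving dynamical system on $L^2(\Omega,\omega)$, and for each $N$ let $V_N$ be the span of a dictionary of $N$ functions, with mpEDMD matrices $\mathbb{K}=\mathbb{K}_{N,M}$ computed from $M$ snapshots (see context). If $\lim_{N\rightarrow\infty}\mathrm{dist}(h,V_{N})=0$ for all $h\in L^2(\Omega,\omega)$ and, for each fixed $N$, the quadrature converges, i.e. $\lim_{M\to\infty}G_{jk}=\langle\psi_k,\psi_j\rangle$ and $\lim_{M\to\infty}A_{jk}=\langle\mathcal{K}\psi_k,\psi_j\rangle$ for $1\le j,k\le N$, then $$ \lim_{N\rightarrow\infty}\limsup_{M\rightarrow\infty} \sup_{\lambda\in \sigma_{\mathrm{ap}}(\mathcal{K})}\mathrm{dist}(\lambda,\sigma(\mathbb{K}))=0. $$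
   Context: Setting. $\Omega\subseteq\mathbb{R}^d$, $\omega$ is a positive measure on $\Omega$, and $F:\Omega\to\Omega$ is measurable and preserves $\omega$. The Koopman operator $\mathcal{K}g=g\circ F$ is an isometry on $L^2(\Omega,\omega)$, whose inner product (linear in the first argument) and norm are $\langle\cdot,\cdot\rangle$ and $\|\cdot\|$. The approximate point spectrum $\sigma_{\mathrm{ap}}(\mathcal{K})$ is the set of $\lambda\in\mathbb{C}$ for which there is a sequence $g_n\in L^2(\Omega,\omega)$ with $\|g_n\|=1$ and $\|(\mathcal{K}-\lambda)g_n\|\to0$. $\sigma(\mathbb{K})$ is the set of eigenvalues of the matrix $\mathbb{K}$. mpEDMD. For each $N$ there is a dictionary $\psi_1,\dots,\psi_N\in L^2(\Omega,\omega)$ (possibly depending on $N$), linearly independent, with span $V_N$. Write $\Psi(\pmb{x})=[\psi_1(\pmb{x})\ \cdots\ \psi_N(\pmb{x})]$. For each $M$ the data are points $\pmb{x}^{(m)}\in\Omega$, $\pmb{y}^{(m)}=F(\pmb{x}^{(m)})$, $m=1,\dots,M$, with quadrature weights $w_m\ge 0$ (points and weights may depend on $M$); $W=\mathrm{diag}(w_1,\dots,w_M)$. $\Psi_X,\Psi_Y\in\mathbb{C}^{M\times N}$ are the matrices whose $m$th rows are $\Psi(\pmb{x}^{(m)})$ and $\Psi(\pmb{y}^{(m)})$. Put $G=\Psi_X^*W\Psi_X$ and $A=\Psi_X^*W\Psi_Y$ (both depend on $N,M$); $G$ is assumed invertible. Take any singular value decomposition $G^{-1/2}A^*G^{-1/2}=U_1\Sigma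 U_2^*$ with $U_1,U_2$ unitary, and set $\mathbb{K}=G^{-1/2}U_2U_1^*G^{1/2}\in\mathbb{C}^{N\times N}$. $\mathrm{dist}(h,V_N)=\inf_{f\in V_N}\|h-f\|$, and $\mathrm{dist}(\lambda,S)=\inf_{z\in S}|\lambda-z|$ for $S\subset\mathbb{C}$. *)

theory Defs
  imports "HOL-Analysis.Analysis" "Jordan_Normal_Form.Spectral_Radius"
begin

text \<open>Elements of the space $L^2(\Omega,\omega)$ are handled through representatives: complex-valued
  measurable functions with integrable squared modulus, with \<open>\<Omega> = space \<omega>\<close>. Functions
  that agree almost everywhere are at distance 0 for \<open>l2_norm\<close>.\<close>

definition l2_space :: "'a measure \<Rightarrow> ('a \<Rightarrow> complex) set" where
  "l2_space \<omega> = {g. g \<in> borel_measurable \<omega> \<and> integrable \<omega> (\<lambda>x. (cmod (g x))\<^sup>2)}"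

definition l2_inner :: "'a measure \<Rightarrow> ('a \<Rightarrow> complex) \<Rightarrow> ('a \<Rightarrow> complex) \<Rightarrow> complex" where
  "l2_inner \<omega> f g = (LINT x|\<omega>. f x * cnj (g x))"

definition l2_norm :: "'a measure \<Rightarrow> ('a \<Rightarrow> complex) \<Rightarrow> real" where
  "l2_norm \<omega> f = sqrt (LINT x|\<omega>. (cmod (f x))\<^sup>2)"

definition l2_dist :: "'a measure \<Rightarrow> ('a \<Rightarrow> complex) \<Rightarrow> ('a \<Rightarrow> complex) set \<Rightarrow> real" where
  "l2_dist \<omega> h V = (INF f\<in>V. l2_norm \<omega> (\<lambda>x. h x - f x))"

definition measure_preserving_map :: "'a measure \<Rightarrow> ('a \<Rightarrow> 'a) \<Rightarrow> bool" where
  "measure_preserving_map \<omega> F \<longleftrightarrow> F \<in> \<omega> \<rightarrow>\<^sub>M \<omega> \<and> distr \<omega> \<omega> F = \<omega>"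

definition koopman :: "('a \<Rightarrow> 'a) \<Rightarrow> ('a \<Rightarrow> complex) \<Rightarrow> ('a \<Rightarrow> complex)" where
  "koopman F g = g \<circ> F"

definition approx_point_spectrum ::
  "'a measure \<Rightarrow> (('a \<Rightarrow> complex) \<Rightarrow> ('a \<Rightarrow> complex)) \<Rightarrow> complex set" where
  "approx_point_spectrum \<omega> T =
    {z. \<exists>g :: nat \<Rightarrow> 'a \<Rightarrow> complex.
          (\<forall>n. g n \<in> l2_space \<omega> \<and> l2_norm \<omega> (g n) = 1) \<and>
          (\<lambda>n. l2_norm \<omega> (\<lambda>x. T (g n) x - z * g n x)) \<longlonglongrightarrow> 0}"

text \<open>A dictionary of size \<open>N\<close> is \<open>\<psi> 0, \<dots>, \<psi> (N - 1)\<close>. Linear independence is that of the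
  classes modulo almost-everywhere equality.\<close>

definition l2_lin_indep :: "'a measure \<Rightarrow> nat \<Rightarrow> (nat \<Rightarrow> 'a \<Rightarrow> complex) \<Rightarrow> bool" where
  "l2_lin_indep \<omega> N \<psi> \<longleftrightarrow>
    (\<forall>c :: nat \<Rightarrow> complex. (AE x in \<omega>. (\<Sum>j<N. c j * \<psi> j x) = 0) \<longrightarrow> (\<forall>j<N. c j = 0))"

definition dictionary_span :: "nat \<Rightarrow> (nat \<Rightarrow> 'a \<Rightarrow> complex) \<Rightarrow> ('a \<Rightarrow> complex) set" where
  "dictionary_span N \<psi> = {f. \<exists>c :: nat \<Rightarrow> complex. f = (\<lambda>x. \<Sum>j<N. c j * \<psi> j x)}"

definition feature_mat :: "nat \<Rightarrow> nat \<Rightarrow> (nat \<Rightarrow> 'a \<Rightarrow> complex) \<Rightarrow> (nat \<Rightarrow> 'a) \<Rightarrow> complex mat" where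
  "feature_mat N M \<psi> x = Matrix.mat M N (\<lambda>(m, j). \<psi> j (x m))"

definition weight_mat :: "nat \<Rightarrow> (nat \<Rightarrow> real) \<Rightarrow> complex mat" where
  "weight_mat M w = mat_diag M (\<lambda>m. complex_of_real (w m))"

definition edmd_G ::
  "nat \<Rightarrow> nat \<Rightarrow> (nat \<Rightarrow> 'a \<Rightarrow> complex) \<Rightarrow> (nat \<Rightarrow> 'a) \<Rightarrow> (nat \<Rightarrow> real) \<Rightarrow> complex mat" where
  "edmd_G N M \<psi> x w =
    mat_adjoint (feature_mat N M \<psi> x) * weight_mat M w * feature_mat N M \<psi> x"

definition edmd_A ::
  "nat \<Rightarrow> nat \<Rightarrow> (nat \<Rightarrow> 'a \<Rightarrow> complex) \<Rightarrow> (nat \<Rightarrow> 'a) \<Rightarrow> (nat \<Rightarrow> 'a) \<Rightarrow> (nat \<Rightarrow> real) \<Rightarrow> complex mat"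
  where
  "edmd_A N M \<psi> x y w =
    mat_adjoint (feature_mat N M \<psi> x) * weight_mat M w * feature_mat N M \<psi> y"

definition unitary_mat :: "nat \<Rightarrow> complex mat \<Rightarrow> bool" where
  "unitary_mat n U \<longleftrightarrow>
    U \<in> carrier_mat n n \<and> mat_adjoint U * U = 1\<^sub>m n \<and> U * mat_adjoint U = 1\<^sub>m n"

definition pos_semidef_mat :: "nat \<Rightarrow> complex mat \<Rightarrow> bool" where
  "pos_semidef_mat n S \<longleftrightarrow>
    S \<in> carrier_mat n n \<and> mat_adjoint S = S \<and>
    (\<forall>v \<in> carrier_vec n. 0 \<le> Re ((S *\<^sub>v v) \<bullet>c v))"

definition is_psd_sqrt :: "nat \<Rightarrow> complex mat \<Rightarrow> complex mat \<Rightarrow> bool" where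
  "is_psd_sqrt n G S \<longleftrightarrow> pos_semidef_mat n S \<and> S * S = G"

definition is_inverse_mat :: "nat \<Rightarrow> complex mat \<Rightarrow> complex mat \<Rightarrow> bool" where
  "is_inverse_mat n S R \<longleftrightarrow> R \<in> carrier_mat n n \<and> inverts_mat S R \<and> inverts_mat R S"

text \<open>\<open>B = U1 * Sg * U2\<^sup>*\<close>; no ordering of the singular values is required.\<close>

definition is_svd :: "nat \<Rightarrow> complex mat \<Rightarrow> complex mat \<Rightarrow> complex mat \<Rightarrow> complex mat \<Rightarrow> bool" where
  "is_svd n B U1 Sg U2 \<longleftrightarrow>
    unitary_mat n U1 \<and> unitary_mat n U2 \<and>
    (\<exists>s :: nat \<Rightarrow> real. (\<forall>i<n. 0 \<le> s i) \<and> Sg = mat_diag n (\<lambda>i. complex_of_real (s i))) \<and>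
    B = U1 * Sg * mat_adjoint U2"

text \<open>The matrix need not be determined by \<open>G\<close> and \<open>A\<close>, since the singular value decomposition is
  not unique; hence a relation. \<open>S\<close> is $G^{1/2}$ and \<open>R\<close> is $G^{-1/2}$.\<close>

definition is_mpedmd_mat :: "nat \<Rightarrow> complex mat \<Rightarrow> complex mat \<Rightarrow> complex mat \<Rightarrow> bool" where
  "is_mpedmd_mat n G A K \<longleftrightarrow>
    (\<exists>S R U1 Sg U2.
       is_psd_sqrt n G S \<and> is_inverse_mat n S R \<and>
       is_svd n (R * mat_adjoint A * R) U1 Sg U2 \<and>
       K = R * U2 * mat_adjoint U1 * S)"

end

theory Submission
  imports Defs
begin

text \<open>
  Write \<open>\<Psi> c\<close> for the function with coefficients \<open>c\<close>, and put \<open>u = G\<^sup>1\<^sup>/\<^sup>2 c\<close>. If \<open>\<Psi> c\<close> is an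
  approximate eigenfunction for \<open>z\<close>, then \<open>B\<^sup>* u \<approx> z u\<close> for \<open>B\<^sup>* = G\<^sup>-\<^sup>1\<^sup>/\<^sup>2 A G\<^sup>-\<^sup>1\<^sup>/\<^sup>2\<close>, a matrix
  which for large \<open>M\<close> is almost a contraction because the Koopman operator is an isometry. In the
  polar decomposition \<open>B\<^sup>* = Q P\<close>, with \<open>Q = U\<^sub>2 U\<^sub>1\<^sup>*\<close> and \<open>P\<close> positive, \<open>|z| = 1\<close> and \<open>P \<lesssim> 1\<close> then
  force \<open>P u \<approx> u\<close>, so \<open>Q u \<approx> z u\<close>. Since \<open>Q\<close> is unitary and similar to the mpEDMD matrix, the
  latter has an eigenvalue close to \<open>z\<close>. Uniformity in \<open>z\<close> comes from a finite net of the
  approximate point spectrum, a subset of the unit circle.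
\<close>

section \<open>Square-integrable functions and the Koopman isometry\<close>

text \<open>The mpEDMD matrix is in general not normal, so a small residual by itself would not
  place an eigenvalue near \<open>z\<close>. In the inner product given by \<open>G\<close> it is
  unitary, and for a unitary matrix the distance from \<open>z\<close> to the eigenvalues is at most
  the relative residual. The factor \<open>P\<close> need not be close to the identity, since
  compression to the span can send some directions almost to 0. It moves only the given vector
  \<open>u\<close> little, because the norm of \<open>P u\<close> is almost that of \<open>u\<close>
  while no singular value exceeds 1 by much. Passing from norms to vectors costs a square root,
  whence the bound \<open>4 * sqrt t\<close>. If singular values vanish, \<open>Q\<close> depends on
  the chosen decomposition; the estimate covers every choice, as it uses only \<open>Q P u\<close>
  and \<open>P u\<close>. The dictionary size at which an approximate eigenfunction is captured
  depends on \<open>z\<close>, and pointwise density supplies no common rate; hence \<open>z\<close>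
  is confined to finitely many values before either limit is taken.\<close>

lemma l2_space_sum:
  assumes "\<And>j. j \<in> J \<Longrightarrow> f j \<in> l2_space \<omega>" "finite J"
  shows "(\<lambda>x. \<Sum>j\<in>J. c j * f j x) \<in> l2_space \<omega>"
  using assms(2,1)
proof (induction J rule: finite_induct)
  case empty
  then show ?case by (simp add: l2_space_def)
next
  case (insert a J)
  let ?u = "\<lambda>x. c a * f a x" and ?v = "\<lambda>x. \<Sum>j\<in>J. c j * f j x"
  have fa: "f a \<in> borel_measurable \<omega>" "integrable \<omega> (\<lambda>x. (cmod (f a x))\<^sup>2)"
    using insert.prems[of a] by (auto simp: l2_space_def)
  have v: "?v \<in> borel_measurable \<omega>" "integrable \<omega> (\<lambda>x. (cmod (?v x))\<^sup>2)"
    using insert.IH insert.prems by (auto simp: l2_space_def)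
  have "integrable \<omega> (\<lambda>x. 2 * (cmod (c a))\<^sup>2 * (cmod (f a x))\<^sup>2 + 2 * (cmod (?v x))\<^sup>2)"
    using fa v by auto
  then have "integrable \<omega> (\<lambda>x. (cmod (?u x + ?v x))\<^sup>2)"
  proof (rule Bochner_Integration.integrable_bound)
    show "AE x in \<omega>. norm ((cmod (?u x + ?v x))\<^sup>2)
        \<le> norm (2 * (cmod (c a))\<^sup>2 * (cmod (f a x))\<^sup>2 + 2 * (cmod (?v x))\<^sup>2)"
    proof (rule AE_I2)
      fix x
      have "(cmod (?u x + ?v x))\<^sup>2 \<le> (cmod (?u x) + cmod (?v x))\<^sup>2"
        by (intro power_mono norm_triangle_ineq) auto
      also have "\<dots> \<le> 2 * (cmod (?u x))\<^sup>2 + 2 * (cmod (?v x))\<^sup>2"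
        using sum_squares_bound[of "cmod (?u x)" "cmod (?v x)"] by (simp add: power2_sum)
      finally show "norm ((cmod (?u x + ?v x))\<^sup>2)
        \<le> norm (2 * (cmod (c a))\<^sup>2 * (cmod (f a x))\<^sup>2 + 2 * (cmod (?v x))\<^sup>2)"
        by (simp add: norm_mult power_mult_distrib)
    qed
  qed (use fa v in measurable)
  moreover have "(\<lambda>x. ?u x + ?v x) \<in> borel_measurable \<omega>"
    using fa v by (intro borel_measurable_add borel_measurable_times) auto
  ultimately show ?case
    using insert.hyps by (simp add: l2_space_def)
qed

lemma l2_space_scale:
  assumes "f \<in> l2_space \<omega>"
  shows "(\<lambda>x. c * f x) \<in> l2_space \<omega>"
  using l2_space_sum[of "{0::nat}" "\<lambda>_. f" \<omega> "\<lambda>_. c"] assms by simp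

lemma l2_space_add:
  assumes "f \<in> l2_space \<omega>" "g \<in> l2_space \<omega>"
  shows "(\<lambda>x. f x + g x) \<in> l2_space \<omega>"
  using l2_space_sum[of "{0, 1::nat}" "\<lambda>j. if j = 0 then f else g" \<omega> "\<lambda>_. 1"] assms by simp

lemma l2_space_diff:
  assumes "f \<in> l2_space \<omega>" "g \<in> l2_space \<omega>"
  shows "(\<lambda>x. f x - g x) \<in> l2_space \<omega>"
  using l2_space_add[OF assms(1) l2_space_scale[OF assms(2), of "-1"]] by simp

lemma l2_inner_integrable:
  assumes "f \<in> l2_space \<omega>" "g \<in> l2_space \<omega>"
  shows "integrable \<omega> (\<lambda>x. f x * cnj (g x))"
proof (rule Bochner_Integration.integrable_bound[of \<omega> "\<lambda>x. (cmod (f x))\<^sup>2 + (cmod (g x))\<^sup>2"])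
  show "AE x in \<omega>. norm (f x * cnj (g x)) \<le> norm ((cmod (f x))\<^sup>2 + (cmod (g x))\<^sup>2)"
  proof (rule AE_I2)
    fix x
    have "2 * (cmod (f x) * cmod (g x)) \<le> (cmod (f x))\<^sup>2 + (cmod (g x))\<^sup>2"
      using sum_squares_bound[of "cmod (f x)" "cmod (g x)"] by simp
    moreover have "0 \<le> cmod (f x) * cmod (g x)" by simp
    ultimately have "cmod (f x) * cmod (g x) \<le> (cmod (f x))\<^sup>2 + (cmod (g x))\<^sup>2"
      by linarith
    then show "norm (f x * cnj (g x)) \<le> norm ((cmod (f x))\<^sup>2 + (cmod (g x))\<^sup>2)"
      by (simp add: norm_mult)
  qed
  have "(\<lambda>x. cnj (g x)) \<in> borel_measurable \<omega>"
    using assms by (auto intro: borel_measurable_continuous_on[OF continuous_on_cnj[OF continuous_on_id]]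
        simp: l2_space_def)
  then show "(\<lambda>x. f x * cnj (g x)) \<in> borel_measurable \<omega>"
    using assms by (intro borel_measurable_times) (auto simp: l2_space_def)
qed (use assms in \<open>auto simp: l2_space_def\<close>)

lemma l2_norm_nonneg: "0 \<le> l2_norm \<omega> f"
  by (simp add: l2_norm_def)

lemma l2_norm_power2: "(l2_norm \<omega> f)\<^sup>2 = (LINT x|\<omega>. (cmod (f x))\<^sup>2)"
  by (simp add: l2_norm_def)

lemma l2_inner_self: "l2_inner \<omega> f f = of_real ((l2_norm \<omega> f)\<^sup>2)"
proof -
  have "l2_inner \<omega> f f = (LINT x|\<omega>. complex_of_real ((cmod (f x))\<^sup>2))"
    unfolding l2_inner_def by (simp only: complex_norm_square)
  also have "\<dots> = of_real (LINT x|\<omega>. (cmod (f x))\<^sup>2)"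
    by (rule integral_complex_of_real)
  finally show ?thesis by (simp add: l2_norm_power2)
qed

lemma l2_inner_sum:
  assumes "finite J" "\<And>j. j \<in> J \<Longrightarrow> f j \<in> l2_space \<omega>" "g \<in> l2_space \<omega>"
  shows "l2_inner \<omega> (\<lambda>x. \<Sum>j\<in>J. c j * f j x) g = (\<Sum>j\<in>J. c j * l2_inner \<omega> (f j) g)"
    and "l2_inner \<omega> g (\<lambda>x. \<Sum>j\<in>J. c j * f j x) = (\<Sum>j\<in>J. cnj (c j) * l2_inner \<omega> g (f j))"
proof -
  have "l2_inner \<omega> (\<lambda>x. \<Sum>j\<in>J. c j * f j x) g = (LINT x|\<omega>. (\<Sum>j\<in>J. c j * (f j x * cnj (g x))))"
    by (simp add: l2_inner_def sum_distrib_right mult.assoc)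
  also have "\<dots> = (\<Sum>j\<in>J. LINT x|\<omega>. c j * (f j x * cnj (g x)))"
    by (intro Bochner_Integration.integral_sum Bochner_Integration.integrable_mult_right
        l2_inner_integrable assms)
  finally show "l2_inner \<omega> (\<lambda>x. \<Sum>j\<in>J. c j * f j x) g = (\<Sum>j\<in>J. c j * l2_inner \<omega> (f j) g)"
    by (simp add: l2_inner_def)
  have "l2_inner \<omega> g (\<lambda>x. \<Sum>j\<in>J. c j * f j x)
      = (LINT x|\<omega>. (\<Sum>j\<in>J. cnj (c j) * (g x * cnj (f j x))))"
    by (simp add: l2_inner_def sum_distrib_left mult_ac)
  also have "\<dots> = (\<Sum>j\<in>J. LINT x|\<omega>. cnj (c j) * (g x * cnj (f j x)))"
    by (intro Bochner_Integration.integral_sum Bochner_Integration.integrable_mult_right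
        l2_inner_integrable assms)
  finally show "l2_inner \<omega> g (\<lambda>x. \<Sum>j\<in>J. c j * f j x) = (\<Sum>j\<in>J. cnj (c j) * l2_inner \<omega> g (f j))"
    by (simp add: l2_inner_def)
qed

text \<open>The optimal weight is t = b / a, which is not admissible when \<open>a\<close> or
  \<open>b\<close> is 0. Shifting both by a small \<open>s\<close> keeps it positive, at a cost
  within the allowance \<open>e\<close>.\<close>

lemma le_mult_if_weighted_AM:
  fixes a b i :: real
  assumes "0 \<le> a" "0 \<le> b" and le: "\<And>t. 0 < t \<Longrightarrow> 2 * i \<le> t * a\<^sup>2 + b\<^sup>2 / t"
  shows "i \<le> a * b"
proof (rule field_le_epsilon)
  fix e :: real
  assume e: "0 < e"
  define s where "s = e / (a + b + 1)"
  have s: "0 < s" using e assms by (simp add: s_def)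
  have "2 * i \<le> (b + s) / (a + s) * a\<^sup>2 + b\<^sup>2 / ((b + s) / (a + s))"
    using s assms by (intro le) auto
  also have "\<dots> \<le> (b + s) * a + b * (a + s)"
  proof (rule add_mono)
    have "a\<^sup>2 \<le> a * (a + s)" using s assms by (simp add: power2_eq_square algebra_simps)
    then have "(b + s) * a\<^sup>2 \<le> (b + s) * (a * (a + s))"
      using s assms by (intro mult_left_mono) auto
    then show "(b + s) / (a + s) * a\<^sup>2 \<le> (b + s) * a"
      using s assms by (simp add: divide_le_eq mult_ac)
    have "b\<^sup>2 \<le> b * (b + s)" using s assms by (simp add: power2_eq_square algebra_simps)
    then have "(a + s) * b\<^sup>2 \<le> (a + s) * (b * (b + s))"
      using s assms by (intro mult_left_mono) auto
    then show "b\<^sup>2 / ((b + s) / (a + s)) \<le> b * (a + s)"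
      using s assms by (simp add: divide_le_eq mult_ac)
  qed
  also have "\<dots> = 2 * (a * b) + s * (a + b)" by (simp add: algebra_simps)
  also have "s * (a + b) \<le> e"
    using e assms by (simp add: s_def divide_le_eq algebra_simps)
  finally show "i \<le> a * b + e" using e by simp
qed

text \<open>The weighted mean inequality is integrated for every weight \<open>t\<close>, and
  \<open>t\<close> is optimised only afterwards, so functions of norm 0 need no separate
  case.\<close>

lemma l2_inner_le:
  assumes f: "f \<in> l2_space \<omega>" and g: "g \<in> l2_space \<omega>"
  shows "cmod (l2_inner \<omega> f g) \<le> l2_norm \<omega> f * l2_norm \<omega> g"
proof (rule le_mult_if_weighted_AM)
  fix t :: real
  assume t: "0 < t"
  have "2 * cmod (l2_inner \<omega> f g) \<le> 2 * (LINT x|\<omega>. cmod (f x * cnj (g x)))"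
    unfolding l2_inner_def by (simp add: integral_norm_bound)
  also have "\<dots> = (LINT x|\<omega>. 2 * cmod (f x * cnj (g x)))" by simp
  also have "\<dots> \<le> (LINT x|\<omega>. t * (cmod (f x))\<^sup>2 + (cmod (g x))\<^sup>2 / t)"
  proof (rule integral_mono)
    show "integrable \<omega> (\<lambda>x. 2 * cmod (f x * cnj (g x)))"
      using l2_inner_integrable[OF f g] by (intro integrable_mult_right integrable_norm)
    show "integrable \<omega> (\<lambda>x. t * (cmod (f x))\<^sup>2 + (cmod (g x))\<^sup>2 / t)"
      using f g by (auto simp: l2_space_def)
    fix x
    have "0 \<le> (t * cmod (f x) - cmod (g x))\<^sup>2 / t" using t by simp
    then show "2 * cmod (f x * cnj (g x)) \<le> t * (cmod (f x))\<^sup>2 + (cmod (g x))\<^sup>2 / t"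
      using t by (simp add: norm_mult power2_eq_square field_simps)
  qed
  also have "\<dots> = t * (l2_norm \<omega> f)\<^sup>2 + (l2_norm \<omega> g)\<^sup>2 / t"
    using f g by (simp add: l2_norm_power2 l2_space_def)
  finally show "2 * cmod (l2_inner \<omega> f g) \<le> t * (l2_norm \<omega> f)\<^sup>2 + (l2_norm \<omega> g)\<^sup>2 / t" .
qed (auto simp: l2_norm_nonneg)

lemma l2_norm_scale: "l2_norm \<omega> (\<lambda>x. c * f x) = cmod c * l2_norm \<omega> f"
  by (simp add: l2_norm_def norm_mult power_mult_distrib real_sqrt_mult)

lemma l2_norm_triangle:
  assumes f: "f \<in> l2_space \<omega>" and g: "g \<in> l2_space \<omega>"
  shows "l2_norm \<omega> (\<lambda>x. f x + g x) \<le> l2_norm \<omega> f + l2_norm \<omega> g"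
proof (rule power2_le_imp_le)
  have "(l2_norm \<omega> (\<lambda>x. f x + g x))\<^sup>2
      = (LINT x|\<omega>. (cmod (f x))\<^sup>2 + 2 * Re (f x * cnj (g x)) + (cmod (g x))\<^sup>2)"
    unfolding l2_norm_power2
    by (intro Bochner_Integration.integral_cong refl)
      (simp add: cmod_power2, simp add: power2_eq_square algebra_simps)
  also have "\<dots> = (l2_norm \<omega> f)\<^sup>2 + 2 * Re (l2_inner \<omega> f g) + (l2_norm \<omega> g)\<^sup>2"
    using f g integrable_Re[OF l2_inner_integrable[OF f g]] integral_Re[OF l2_inner_integrable[OF f g]]
    by (simp add: l2_norm_power2 l2_space_def l2_inner_def del: times_complex.sel)
  also have "Re (l2_inner \<omega> f g) \<le> l2_norm \<omega> f * l2_norm \<omega> g"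
    using l2_inner_le[OF f g] complex_Re_le_cmod order_trans by blast
  finally show "(l2_norm \<omega> (\<lambda>x. f x + g x))\<^sup>2 \<le> (l2_norm \<omega> f + l2_norm \<omega> g)\<^sup>2"
    by (simp add: power2_sum)
qed (simp add: l2_norm_nonneg)

lemma l2_norm_minus: "l2_norm \<omega> (\<lambda>x. f x - g x) = l2_norm \<omega> (\<lambda>x. g x - f x)"
  by (simp add: l2_norm_def norm_minus_commute)

lemma l2_norm_eq_0_AE:
  assumes "f \<in> l2_space \<omega>" "l2_norm \<omega> f = 0"
  shows "AE x in \<omega>. f x = 0"
proof -
  have "(LINT x|\<omega>. (cmod (f x))\<^sup>2) = 0"
    using assms(2) l2_norm_power2[of \<omega> f] by simp
  then have "AE x in \<omega>. (cmod (f x))\<^sup>2 = 0"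
    using assms(1) by (subst (asm) integral_nonneg_eq_0_iff_AE) (auto simp: l2_space_def)
  then show ?thesis by simp
qed

lemma
  assumes F: "measure_preserving_map \<omega> F" and g: "g \<in> l2_space \<omega>"
  shows koopman_l2_space: "koopman F g \<in> l2_space \<omega>"
    and koopman_isometry: "l2_norm \<omega> (koopman F g) = l2_norm \<omega> g"
proof -
  have m: "F \<in> \<omega> \<rightarrow>\<^sub>M \<omega>" and d: "distr \<omega> \<omega> F = \<omega>"
    using F by (auto simp: measure_preserving_map_def)
  have g': "g \<in> borel_measurable \<omega>" "integrable \<omega> (\<lambda>x. (cmod (g x))\<^sup>2)"
    using g by (auto simp: l2_space_def)
  have "integrable \<omega> (\<lambda>x. (cmod (g (F x)))\<^sup>2)"
    using integrable_distr_eq[OF m, of "\<lambda>x. (cmod (g x))\<^sup>2"] g' d by simp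
  then show "koopman F g \<in> l2_space \<omega>"
    using m g' by (auto simp: l2_space_def koopman_def comp_def)
  show "l2_norm \<omega> (koopman F g) = l2_norm \<omega> g"
    using integral_distr[OF m, of "\<lambda>x. (cmod (g x))\<^sup>2"] g' d
    by (simp add: l2_norm_def koopman_def)
qed

text \<open>For an isometry the norms of T g and z g differ by at most the residual, which forces
  modulus 1 in the limit. This is special to approximate eigenvectors: the full spectrum of a
  non-surjective isometry is the closed unit disc.\<close>

lemma koopman_approx_point_spectrum_cmod:
  assumes F: "measure_preserving_map \<omega> F"
    and z: "z \<in> approx_point_spectrum \<omega> (koopman F)"
  shows "cmod z = 1"
proof -
  obtain g where g: "\<And>n. g n \<in> l2_space \<omega>" "\<And>n. l2_norm \<omega> (g n) = 1"
    and lim: "(\<lambda>n. l2_norm \<omega> (\<lambda>x. koopman F (g n) x - z * g n x)) \<longlonglongrightarrow> 0"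
    using z by (auto simp: approx_point_spectrum_def)
  have "\<bar>cmod z - 1\<bar> \<le> l2_norm \<omega> (\<lambda>x. koopman F (g n) x - z * g n x)" (is "_ \<le> ?r n") for n
  proof -
    note k = koopman_l2_space[OF F g(1)[of n]] and i = koopman_isometry[OF F g(1)[of n]]
    note zg = l2_space_scale[OF g(1)[of n], of z]
    have "l2_norm \<omega> (koopman F (g n)) \<le> ?r n + cmod z"
      using l2_norm_triangle[OF l2_space_diff[OF k zg] zg] by (simp add: l2_norm_scale g(2))
    moreover have "cmod z \<le> ?r n + l2_norm \<omega> (koopman F (g n))"
      using l2_norm_triangle[OF l2_space_diff[OF zg k] k]
        l2_norm_minus[of \<omega> "\<lambda>x. z * g n x" "koopman F (g n)"]
      by (simp add: l2_norm_scale g(2))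
    ultimately show ?thesis by (simp add: i g(2))
  qed
  then have "\<bar>cmod z - 1\<bar> \<le> 0"
    by (intro LIMSEQ_le_const[OF lim]) auto
  then show ?thesis by simp
qed

section \<open>Unitary matrices\<close>

lemma mat_adjoint_carrier [simp]:
  "A \<in> carrier_mat m n \<Longrightarrow> mat_adjoint A \<in> carrier_mat n m"
  by (auto simp: mat_adjoint_def)

lemma mat_adjoint_dim [simp]:
  "dim_row (mat_adjoint A) = dim_col A" "dim_col (mat_adjoint A) = dim_row A"
  by (simp_all add: mat_adjoint_def)

lemma mat_adjoint_index:
  assumes "A \<in> carrier_mat m n" "i < n" "j < m"
  shows "mat_adjoint A $$ (i, j) = cnj (A $$ (j, i) :: complex)"
  using assms by (auto simp: mat_adjoint_def mat_of_rows_index)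

lemma mat_adjoint_adjoint:
  assumes "(A :: complex mat) \<in> carrier_mat m n"
  shows "mat_adjoint (mat_adjoint A) = A"
  using assms mat_adjoint_carrier[OF assms]
    mat_adjoint_carrier[OF mat_adjoint_carrier[OF assms]]
  by (intro eq_matI) (auto simp: mat_adjoint_index[of _ n m] mat_adjoint_index[of _ m n])

lemma mat_adjoint_mult:
  assumes A: "(A :: complex mat) \<in> carrier_mat m n" and B: "B \<in> carrier_mat n p"
  shows "mat_adjoint (A * B) = mat_adjoint B * mat_adjoint A"
proof (rule eq_matI)
  fix i j
  assume "i < dim_row (mat_adjoint B * mat_adjoint A)" "j < dim_col (mat_adjoint B * mat_adjoint A)"
  then have ij: "i < p" "j < m"
    using mat_adjoint_carrier[OF A] mat_adjoint_carrier[OF B] by auto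
  have "mat_adjoint (A * B) $$ (i, j) = cnj (\<Sum>k<n. A $$ (j, k) * B $$ (k, i))"
    using A B ij by (subst mat_adjoint_index[of _ m p]) (auto simp: scalar_prod_def lessThan_atLeast0)
  also have "\<dots> = (\<Sum>k<n. mat_adjoint B $$ (i, k) * mat_adjoint A $$ (k, j))"
    using A B ij by (simp add: mat_adjoint_index[of _ m n] mat_adjoint_index[of _ n p] mult.commute)
  also have "\<dots> = (mat_adjoint B * mat_adjoint A) $$ (i, j)"
    using mat_adjoint_carrier[OF A] mat_adjoint_carrier[OF B] A B ij
    by (auto simp: scalar_prod_def lessThan_atLeast0)
  finally show "mat_adjoint (A * B) $$ (i, j) = (mat_adjoint B * mat_adjoint A) $$ (i, j)" .
qed (use mat_adjoint_carrier[OF A] mat_adjoint_carrier[OF B] mat_adjoint_carrier[of "A * B" m p] A B in auto)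

lemma cscalar_prod_mat_adjoint:
  assumes A: "(A :: complex mat) \<in> carrier_mat m n" and v: "v \<in> carrier_vec n" and w: "w \<in> carrier_vec m"
  shows "(A *\<^sub>v v) \<bullet>c w = v \<bullet>c (mat_adjoint A *\<^sub>v w)"
proof -
  have "(A *\<^sub>v v) \<bullet>c w = (\<Sum>i<m. \<Sum>j<n. A $$ (i, j) * v $ j * cnj (w $ i))"
    using A v w by (simp add: scalar_prod_def lessThan_atLeast0 sum_distrib_right)
  also have "\<dots> = (\<Sum>j<n. \<Sum>i<m. A $$ (i, j) * v $ j * cnj (w $ i))"
    by (rule sum.swap)
  also have "\<dots> = v \<bullet>c (mat_adjoint A *\<^sub>v w)"
    using A v w mat_adjoint_carrier[OF A]
    by (auto simp: scalar_prod_def lessThan_atLeast0 sum_distrib_left mat_adjoint_index[of _ m n]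
        mult_ac intro!: sum.cong)
  finally show ?thesis .
qed

text \<open>Expressed through \<open>L2_set\<close>, so that the Minkowski and Cauchy-Schwarz
  inequalities for finite sums carry over.\<close>

definition cvec_norm :: "complex vec \<Rightarrow> real" where
  "cvec_norm v = L2_set (\<lambda>i. cmod (v $ i)) {..<dim_vec v}"

lemma cvec_norm_nonneg [simp]: "0 \<le> cvec_norm v"
  by (simp add: cvec_norm_def)

lemma cscalar_prod_self: "v \<bullet>c v = of_real ((cvec_norm v)\<^sup>2)"
  by (simp add: cvec_norm_def L2_set_def sum_nonneg scalar_prod_def lessThan_atLeast0
      complex_norm_square del: of_real_power)

lemma cvec_norm_power2: "(cvec_norm v)\<^sup>2 = Re (v \<bullet>c v)"
  by (simp add: cscalar_prod_self del: of_real_power)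

lemma cscalar_prod_le:
  assumes "v \<in> carrier_vec n" "w \<in> carrier_vec n"
  shows "cmod (v \<bullet>c w) \<le> cvec_norm v * cvec_norm w"
proof -
  have "cmod (v \<bullet>c w) \<le> (\<Sum>i<n. \<bar>cmod (v $ i)\<bar> * \<bar>cmod (w $ i)\<bar>)"
    using assms by (auto simp: scalar_prod_def lessThan_atLeast0 norm_mult intro: sum_norm_le)
  also have "\<dots> \<le> cvec_norm v * cvec_norm w"
    using L2_set_mult_ineq[of "\<lambda>i. cmod (v $ i)" "\<lambda>i. cmod (w $ i)" "{..<n}"] assms
    by (simp add: cvec_norm_def)
  finally show ?thesis .
qed

lemma cvec_norm_triangle:
  assumes "v \<in> carrier_vec n" "w \<in> carrier_vec n"
  shows "cvec_norm (v + w) \<le> cvec_norm v + cvec_norm w"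
proof -
  have "cvec_norm (v + w) \<le> L2_set (\<lambda>i. cmod (v $ i) + cmod (w $ i)) {..<n}"
    using assms by (auto simp: cvec_norm_def intro!: L2_set_mono norm_triangle_ineq)
  also have "\<dots> \<le> cvec_norm v + cvec_norm w"
    using assms by (auto simp: cvec_norm_def intro: L2_set_triangle_ineq)
  finally show ?thesis .
qed

lemma cvec_norm_smult: "cvec_norm (c \<cdot>\<^sub>v v) = cmod c * cvec_norm v"
proof -
  have "cvec_norm (c \<cdot>\<^sub>v v) = L2_set (\<lambda>i. cmod c * cmod (v $ i)) {..<dim_vec v}"
    by (auto simp: cvec_norm_def norm_mult intro: L2_set_cong)
  then show ?thesis by (simp add: cvec_norm_def L2_set_right_distrib)
qed

lemma cvec_norm_eq_0:
  assumes "v \<in> carrier_vec n"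
  shows "cvec_norm v = 0 \<longleftrightarrow> v = 0\<^sub>v n"
  using assms by (auto simp: cvec_norm_def L2_set_eq_0_iff intro!: eq_vecI)

lemma cvec_norm_unit_vec:
  assumes "i < n"
  shows "cvec_norm (unit_vec n i) = 1"
proof -
  have "(cvec_norm (unit_vec n i))\<^sup>2 = 1"
    using assms by (simp add: cvec_norm_power2)
  then show ?thesis
    by (metis cvec_norm_nonneg power2_eq_iff_nonneg zero_le_one one_power2)
qed

lemma unitary_matD:
  assumes "unitary_mat n U"
  shows "U \<in> carrier_mat n n" "mat_adjoint U \<in> carrier_mat n n"
    "mat_adjoint U * U = 1\<^sub>m n" "U * mat_adjoint U = 1\<^sub>m n"
  using assms by (auto simp: unitary_mat_def)

lemma unitary_mat_adjoint:
  assumes "unitary_mat n U"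
  shows "unitary_mat n (mat_adjoint U)"
  using unitary_matD[OF assms] mat_adjoint_adjoint[OF unitary_matD(1)[OF assms]]
  by (simp add: unitary_mat_def)

lemma unitary_mat_cvec_norm:
  assumes U: "unitary_mat n U" and v: "v \<in> carrier_vec n"
  shows "cvec_norm (U *\<^sub>v v) = cvec_norm v"
proof -
  note U' = unitary_matD[OF U]
  have "(U *\<^sub>v v) \<bullet>c (U *\<^sub>v v) = v \<bullet>c (mat_adjoint U *\<^sub>v (U *\<^sub>v v))"
    using U' v by (intro cscalar_prod_mat_adjoint) auto
  also have "mat_adjoint U *\<^sub>v (U *\<^sub>v v) = (mat_adjoint U * U) *\<^sub>v v"
    using U' v by (intro assoc_mult_mat_vec[symmetric]) (rule U' v)+
  also have "\<dots> = v" using U' v by simp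
  finally have "(cvec_norm (U *\<^sub>v v))\<^sup>2 = (cvec_norm v)\<^sup>2"
    by (simp only: cvec_norm_power2)
  then show ?thesis by simp
qed

text \<open>For unimodular \<open>z\<close> the adjoint of \<open>T = U - z\<close> is \<open>T\<^sup>* = - cnj z U\<^sup>* T\<close>, so \<open>T\<^sup>* T\<close> and
  \<open>T T\<close> have the same norm at every vector.\<close>

lemma unitary_shift_log_convex:
  assumes U: "unitary_mat n U" and z: "cmod z = 1" and v: "v \<in> carrier_vec n"
  defines "T \<equiv> \<lambda>w. U *\<^sub>v w - z \<cdot>\<^sub>v w"
  shows "(cvec_norm (T v))\<^sup>2 \<le> cvec_norm v * cvec_norm (T (T v))"
proof -
  note U' = unitary_matD[OF U]
  let ?w = "T v" and ?a = "mat_adjoint U *\<^sub>v T v"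
  have Tw: "T ?w = U *\<^sub>v ?w - z \<cdot>\<^sub>v ?w" by (simp only: T_def)
  have w: "?w \<in> carrier_vec n" and Uv: "U *\<^sub>v v \<in> carrier_vec n" using U' v by (auto simp: T_def)
  have Uw: "U *\<^sub>v ?w \<in> carrier_vec n" and a: "?a \<in> carrier_vec n"
    using mult_mat_vec_carrier[OF U'(1) w] mult_mat_vec_carrier[OF U'(2) w] by auto
  \<comment> \<open>\<open>?x\<close> is the adjoint of T applied to T v, so the squared norm of T v
    is the inner product of \<open>v\<close> with \<open>?x\<close>.\<close>
  let ?x = "?a - cnj z \<cdot>\<^sub>v ?w"
  have x: "?x \<in> carrier_vec n" using a w by simp
  have "?w \<bullet>c ?w = (U *\<^sub>v v) \<bullet>c ?w - (z \<cdot>\<^sub>v v) \<bullet>c ?w"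
    unfolding T_def using Uv v w[unfolded T_def]
    by (intro minus_scalar_prod_distrib[of _ n]) auto
  also have "(U *\<^sub>v v) \<bullet>c ?w = v \<bullet>c ?a"
    using U' v w by (intro cscalar_prod_mat_adjoint) auto
  also have "v \<bullet>c ?a - (z \<cdot>\<^sub>v v) \<bullet>c ?w = v \<bullet>c ?x"
  proof -
    have "conjugate ?x = conjugate ?a - z \<cdot>\<^sub>v conjugate ?w"
      using a w U' by (intro eq_vecI) auto
    then show ?thesis
      using v a w by (simp add: scalar_prod_minus_distrib[of _ n])
  qed
  finally have "(cvec_norm ?w)\<^sup>2 \<le> cvec_norm v * cvec_norm ?x"
    using cscalar_prod_le[OF v x] complex_Re_le_cmod[of "v \<bullet>c ?x"]
    by (simp add: cvec_norm_power2)
  moreover have "cvec_norm ?x = cvec_norm (T ?w)"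
  proof -
    have "mat_adjoint U *\<^sub>v T ?w = mat_adjoint U *\<^sub>v (U *\<^sub>v ?w) - z \<cdot>\<^sub>v ?a"
      unfolding Tw using U' w Uw by (simp add: mult_minus_distrib_mat_vec[of _ n n] mult_mat_vec[of _ n n])
    also have "mat_adjoint U *\<^sub>v (U *\<^sub>v ?w) = ?w"
      using U' w by (simp flip: assoc_mult_mat_vec[of _ n n _ n])
    also have "?w - z \<cdot>\<^sub>v ?a = (- z) \<cdot>\<^sub>v ?x"
    proof (rule eq_vecI)
      fix i
      assume "i < dim_vec (- z \<cdot>\<^sub>v ?x)"
      then have i: "i < n" using carrier_vecD[OF w] by simp
      have "z * cnj z = 1"
        using z by (simp flip: complex_norm_square)
      then have zz: "z * (cnj z * ?w $ i) = ?w $ i" by (simp flip: mult.assoc)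
      have l: "(?w - z \<cdot>\<^sub>v ?a) $ i = ?w $ i - z * ?a $ i"
        using i carrier_vecD[OF a] by (simp del: index_mult_mat_vec dim_mult_mat_vec)
      have r: "(- z \<cdot>\<^sub>v ?x) $ i = - z * (?a $ i - cnj z * ?w $ i)"
        using i carrier_vecD[OF a] carrier_vecD[OF w] by (simp del: index_mult_mat_vec dim_mult_mat_vec)
      show "(?w - z \<cdot>\<^sub>v ?a) $ i = (- z \<cdot>\<^sub>v ?x) $ i"
        unfolding l r by (simp add: right_diff_distrib zz del: index_mult_mat_vec)
    qed (use a w U' in auto)
    finally have "cvec_norm (mat_adjoint U *\<^sub>v T ?w) = cvec_norm ?x"
      using z by (simp add: cvec_norm_smult)
    moreover have "T ?w \<in> carrier_vec n" using Uw w by (simp add: Tw)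
    ultimately show ?thesis
      using unitary_mat_cvec_norm[OF unitary_mat_adjoint[OF U]] by metis
  qed
  ultimately show ?thesis by simp
qed

text \<open>\<open>norm_bound\<close> is an entrywise bound, which is what the spectral radius
  criterion gives for matrix powers. A crude estimate is enough: the right-hand side depends on the
  bound only, not on the exponent of the power.\<close>

lemma norm_bound_cvec_norm_le:
  assumes A: "(A :: complex mat) \<in> carrier_mat n n" and v: "v \<in> carrier_vec n" and b: "norm_bound A b"
  shows "cvec_norm (A *\<^sub>v v) \<le> (\<Sum>i<n. \<Sum>j<n. b * cmod (v $ j))"
proof -
  have "cvec_norm (A *\<^sub>v v) \<le> (\<Sum>i<n. cmod ((A *\<^sub>v v) $ i))"
    using A L2_set_le_sum[of "{..<n}" "\<lambda>i. cmod ((A *\<^sub>v v) $ i)"] by (simp add: cvec_norm_def)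
  also have "\<dots> \<le> (\<Sum>i<n. \<Sum>j<n. b * cmod (v $ j))"
  proof (rule sum_mono)
    fix i
    assume i: "i \<in> {..<n}"
    have "cmod ((A *\<^sub>v v) $ i) = cmod (\<Sum>j<n. A $$ (i, j) * v $ j)"
      using A v i by (simp add: scalar_prod_def lessThan_atLeast0)
    also have "\<dots> \<le> (\<Sum>j<n. cmod (A $$ (i, j)) * cmod (v $ j))"
      by (rule sum_norm_le) (simp add: norm_mult)
    also have "\<dots> \<le> (\<Sum>j<n. b * cmod (v $ j))"
      using b A i by (intro sum_mono mult_right_mono) (auto simp: norm_bound_def)
    finally show "cmod ((A *\<^sub>v v) $ i) \<le> (\<Sum>j<n. b * cmod (v $ j))" .
  qed
  finally show ?thesis .
qed

text \<open>The hypothesis \<open>step\<close> says that expansion by \<open>q\<close> is inherited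
  by the next vector of the orbit, so the factors multiply. The induction peels off the innermost
  \<open>B\<close>, hence \<open>w\<close> is arbitrary.\<close>

lemma pow_mat_cvec_norm_growth:
  assumes B: "B \<in> carrier_mat n n" and q: "0 \<le> q"
    and step: "\<And>w. w \<in> carrier_vec n \<Longrightarrow> q * cvec_norm w \<le> cvec_norm (B *\<^sub>v w) \<Longrightarrow>
      q * cvec_norm (B *\<^sub>v w) \<le> cvec_norm (B *\<^sub>v (B *\<^sub>v w))"
    and w: "w \<in> carrier_vec n" "q * cvec_norm w \<le> cvec_norm (B *\<^sub>v w)"
  shows "q ^ k * cvec_norm w \<le> cvec_norm ((B ^\<^sub>m k) *\<^sub>v w)"
  using w
proof (induction k arbitrary: w)
  case 0
  then show ?case using B by simp
next
  case (Suc k)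
  have Bw: "B *\<^sub>v w \<in> carrier_vec n" using B Suc.prems(1) by (rule mult_mat_vec_carrier)
  have "q ^ Suc k * cvec_norm w = q ^ k * (q * cvec_norm w)" by simp
  also have "\<dots> \<le> q ^ k * cvec_norm (B *\<^sub>v w)"
    using Suc.prems(2) q by (intro mult_left_mono) auto
  also have "\<dots> \<le> cvec_norm ((B ^\<^sub>m k) *\<^sub>v (B *\<^sub>v w))"
    by (rule Suc.IH[OF Bw step[OF Suc.prems]])
  also have "(B ^\<^sub>m k) *\<^sub>v (B *\<^sub>v w) = (B ^\<^sub>m Suc k) *\<^sub>v w"
    using B Suc.prems(1) pow_carrier_mat[OF B, of k] by (simp add: assoc_mult_mat_vec[of _ n n _ n])
  finally show ?case .
qed

text \<open>If all eigenvalues were farther than \<open>s\<close> from \<open>z\<close>, then \<open>B = s (U - z)\<^sup>-\<^sup>1\<close> would have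
  spectral radius below 1 and hence bounded powers, whereas by log-convexity the norms of
  \<open>B\<^sup>k (U - z) v\<close> grow at least geometrically.\<close>

lemma unitary_mat_eigenvalue_near:
  assumes U: "unitary_mat n U" and z: "cmod z = 1"
    and v: "v \<in> carrier_vec n" "v \<noteq> 0\<^sub>v n"
  obtains \<mu> where "eigenvalue U \<mu>" "cmod (\<mu> - z) * cvec_norm v \<le> cvec_norm (U *\<^sub>v v - z \<cdot>\<^sub>v v)"
proof (rule ccontr)
  assume "\<not> thesis"
  with that have far: "cvec_norm (U *\<^sub>v v - z \<cdot>\<^sub>v v) < cmod (\<mu> - z) * cvec_norm v"
    if "eigenvalue U \<mu>" for \<mu>
    using that by force
  note U' = unitary_matD[OF U]
  have n: "0 < n" using v by (cases n) auto
  have v_pos: "0 < cvec_norm v" using cvec_norm_eq_0[OF v(1)] v(2) cvec_norm_nonneg[of v] by linarith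
  define T where "T = U - z \<cdot>\<^sub>m 1\<^sub>m n"
  have T: "T \<in> carrier_mat n n" using U' by (auto simp: T_def)
  have Tw: "T *\<^sub>v w = U *\<^sub>v w - z \<cdot>\<^sub>v w" if "w \<in> carrier_vec n" for w
  proof -
    have "T *\<^sub>v w = U *\<^sub>v w - (z \<cdot>\<^sub>m 1\<^sub>m n) *\<^sub>v w"
      unfolding T_def using U' that by (intro minus_mult_distrib_mat_vec) auto
    also have "(z \<cdot>\<^sub>m 1\<^sub>m n) *\<^sub>v w = z \<cdot>\<^sub>v w"
      using that by (intro eq_vecI) (auto simp: scalar_prod_def if_distrib[of "\<lambda>x. _ * x * _"] row_def cong: if_cong)
    finally show ?thesis .
  qed
  \<comment> \<open>Otherwise \<open>z\<close> would itself be an eigenvalue, at distance 0, against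
    \<open>far\<close>.\<close>
  have "det T \<noteq> 0"
  proof
    assume "det T = 0"
    then obtain x where x: "x \<in> carrier_vec n" "x \<noteq> 0\<^sub>v n" "T *\<^sub>v x = 0\<^sub>v n"
      using det_0_iff_vec_prod_zero[OF T] by auto
    have "U *\<^sub>v x = z \<cdot>\<^sub>v x"
    proof (rule eq_vecI)
      fix i assume "i < dim_vec (z \<cdot>\<^sub>v x)"
      then show "(U *\<^sub>v x) $ i = (z \<cdot>\<^sub>v x) $ i"
        using arg_cong[OF x(3)[unfolded Tw[OF x(1)]], of "\<lambda>u. u $ i"] x U' by auto
    qed (use x U' in auto)
    then have "eigenvalue U z" using x U' by (auto simp: eigenvalue_def eigenvector_def)
    from far[OF this] show False
      using cvec_norm_nonneg[of "U *\<^sub>v v - z \<cdot>\<^sub>v v"] by simp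
  qed
  then obtain W where W: "W \<in> carrier_mat n n" "W * T = 1\<^sub>m n" "T * W = 1\<^sub>m n"
    using det_non_zero_imp_unit[OF T, of "()"] by (auto simp: Units_def ring_mat_def)
  have TW: "T *\<^sub>v (W *\<^sub>v x) = x" "W *\<^sub>v (T *\<^sub>v x) = x" if "x \<in> carrier_vec n" for x
    using that W T by (simp_all flip: assoc_mult_mat_vec[of _ n n _ n])
  \<comment> \<open>Finiteness of the spectrum makes the least distance attained, so the strict
    inequality in \<open>far\<close> survives for \<open>d\<close> and leaves room for
    \<open>s\<close>.\<close>
  define d where "d = Min ((\<lambda>\<mu>. cmod (\<mu> - z)) ` spectrum U)"
  have fin: "finite (spectrum U)" and ne: "spectrum U \<noteq> {}"
    using card_finite_spectrum[OF U'(1)] spectrum_non_empty[OF U'(1)] n by auto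
  have d_le: "d \<le> cmod (\<mu> - z)" if "eigenvalue U \<mu>" for \<mu>
    using fin that unfolding d_def by (intro Min_le) (auto simp: spectrum_def)
  have "d \<in> (\<lambda>\<mu>. cmod (\<mu> - z)) ` spectrum U"
    unfolding d_def using fin ne by (intro Min_in) auto
  then have "cvec_norm (T *\<^sub>v v) < d * cvec_norm v"
    using far Tw[OF v(1)] by (auto simp: spectrum_def)
  then have "cvec_norm (T *\<^sub>v v) / cvec_norm v < d" using v_pos by (simp add: divide_less_eq)
  \<comment> \<open>Both strict inequalities matter: s < d puts the spectral radius of
    \<open>B\<close> below 1, and the lower bound makes the growth factor \<open>q\<close> exceed
    1.\<close>
  then obtain s where s: "cvec_norm (T *\<^sub>v v) / cvec_norm v < s" "s < d"
    using dense by blast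
  then have s_lt: "cvec_norm (T *\<^sub>v v) < s * cvec_norm v" using v_pos by (simp add: divide_less_eq)
  have s_pos: "0 < s" using s(1) v_pos by (smt (verit) cvec_norm_nonneg divide_nonneg_pos)
  define B where "B = complex_of_real s \<cdot>\<^sub>m W"
  have B: "B \<in> carrier_mat n n" using W by (simp add: B_def)
  have Bw: "B *\<^sub>v w = complex_of_real s \<cdot>\<^sub>v (W *\<^sub>v w)" if "w \<in> carrier_vec n" for w
    using W that by (intro eq_vecI) (auto simp: B_def)
  have TB: "T *\<^sub>v (B *\<^sub>v w) = complex_of_real s \<cdot>\<^sub>v w" if w: "w \<in> carrier_vec n" for w
    using Bw[OF w] TW[OF w] mult_mat_vec_carrier[OF W(1) w] mult_mat_vec[OF T] by simp
  \<comment> \<open>An eigenvalue \<nu> of \<open>B\<close> comes from the eigenvalue z + s / \<nu>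
    of \<open>U\<close>. Its distance s / |\<nu>| from \<open>z\<close> is at least d > s.\<close>
  have "spectral_radius B < 1"
  proof -
    obtain \<nu> where \<nu>: "\<nu> \<in> spectrum B" "spectral_radius B = cmod \<nu>"
      using spectral_radius_mem_max(1)[OF B n] by auto
    then obtain x where x: "x \<in> carrier_vec n" "x \<noteq> 0\<^sub>v n" "B *\<^sub>v x = \<nu> \<cdot>\<^sub>v x"
      using B by (auto simp: spectrum_def eigenvalue_def eigenvector_def)
    have eq: "complex_of_real s \<cdot>\<^sub>v x = \<nu> \<cdot>\<^sub>v (U *\<^sub>v x - z \<cdot>\<^sub>v x)"
      using TB[OF x(1)] x(3) mult_mat_vec[OF T x(1)] Tw[OF x(1)] by simp
    have \<nu>0: "\<nu> \<noteq> 0"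
    proof
      assume "\<nu> = 0"
      then have "cvec_norm (complex_of_real s \<cdot>\<^sub>v x) = 0"
        unfolding eq cvec_norm_smult by simp
      then show False using s_pos cvec_norm_eq_0[OF x(1)] x(2) by (simp add: cvec_norm_smult)
    qed
    have "U *\<^sub>v x = (z + s / \<nu>) \<cdot>\<^sub>v x"
    proof (rule eq_vecI)
      fix i assume i: "i < dim_vec ((z + s / \<nu>) \<cdot>\<^sub>v x)"
      then have "s * x $ i = \<nu> * ((U *\<^sub>v x) $ i - z * x $ i)"
        using arg_cong[OF eq, of "\<lambda>u. u $ i"] x U' by auto
      then have "(U *\<^sub>v x) $ i - z * x $ i = s / \<nu> * x $ i"
        using \<nu>0 by (simp add: field_simps)
      then have "(U *\<^sub>v x) $ i = (z + s / \<nu>) * x $ i"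
        by (simp add: distrib_right diff_eq_eq add.commute)
      then show "(U *\<^sub>v x) $ i = ((z + s / \<nu>) \<cdot>\<^sub>v x) $ i" using i by simp
    qed (use x U' in auto)
    then have "eigenvalue U (z + s / \<nu>)"
      using x U' by (auto simp: eigenvalue_def eigenvector_def)
    from d_le[OF this] s(2) have "s < s / cmod \<nu>"
      using s_pos by (simp add: norm_divide)
    then show ?thesis using \<nu>(2) \<nu>0 s_pos by (simp add: less_divide_eq)
  qed
  then obtain c where c: "\<And>k. norm_bound (B ^\<^sub>m k) c"
    using spectral_radius_jnf_norm_bound_less_1_upper_triangular[OF B] by auto
  \<comment> \<open>Log-convexity of T is used at B (B w), where each application of T removes one
    \<open>B\<close> at the price of the scalar \<open>s\<close>.\<close>
  have convex: "(cvec_norm (B *\<^sub>v w))\<^sup>2 \<le> cvec_norm w * cvec_norm (B *\<^sub>v (B *\<^sub>v w))"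
    if w: "w \<in> carrier_vec n" for w
  proof -
    let ?y = "B *\<^sub>v (B *\<^sub>v w)"
    have b: "B *\<^sub>v w \<in> carrier_vec n" using B w by (rule mult_mat_vec_carrier)
    have y: "?y \<in> carrier_vec n" using B b by (rule mult_mat_vec_carrier)
    have Ty: "T *\<^sub>v ?y = complex_of_real s \<cdot>\<^sub>v (B *\<^sub>v w)" by (rule TB[OF b])
    have "T *\<^sub>v (T *\<^sub>v ?y) = complex_of_real s \<cdot>\<^sub>v (complex_of_real s \<cdot>\<^sub>v w)"
      unfolding Ty using mult_mat_vec[OF T b] TB[OF w] by simp
    moreover have "(cvec_norm (T *\<^sub>v ?y))\<^sup>2 \<le> cvec_norm ?y * cvec_norm (T *\<^sub>v (T *\<^sub>v ?y))"
      using unitary_shift_log_convex[OF U z y] Tw[OF y] Tw[OF mult_mat_vec_carrier[OF T y]] by simp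
    ultimately have "s\<^sup>2 * (cvec_norm (B *\<^sub>v w))\<^sup>2 \<le> s\<^sup>2 * (cvec_norm w * cvec_norm ?y)"
      using s_pos by (simp add: Ty cvec_norm_smult power_mult_distrib power2_eq_square mult_ac)
    then show ?thesis using s_pos by simp
  qed
  \<comment> \<open>The orbit starts at T v because B (T v) = s v, so already its first step expands
    by \<open>q\<close>.\<close>
  let ?w = "T *\<^sub>v v"
  have w: "?w \<in> carrier_vec n" using T v(1) by (rule mult_mat_vec_carrier)
  have w_pos: "0 < cvec_norm ?w"
  proof (rule ccontr)
    assume "\<not> 0 < cvec_norm ?w"
    then have "?w = 0\<^sub>v n" using cvec_norm_eq_0[OF w] cvec_norm_nonneg[of ?w] by linarith
    then have "v = W *\<^sub>v 0\<^sub>v n" using TW(2)[OF v(1)] by simp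
    then show False using v(2) W(1) by auto
  qed
  have Bw_norm: "cvec_norm (B *\<^sub>v ?w) = s * cvec_norm v"
    using Bw[OF w] TW(2)[OF v(1)] s_pos by (simp add: cvec_norm_smult)
  define q where "q = s * cvec_norm v / cvec_norm ?w"
  have q: "1 < q" using s_lt w_pos by (simp add: q_def less_divide_eq)
  have growth: "q ^ k * cvec_norm ?w \<le> cvec_norm ((B ^\<^sub>m k) *\<^sub>v ?w)" for k
  proof (rule pow_mat_cvec_norm_growth[OF B])
    show "q * cvec_norm ?w \<le> cvec_norm (B *\<^sub>v ?w)" using w_pos by (simp add: q_def Bw_norm)
    fix u
    assume u: "u \<in> carrier_vec n" and le: "q * cvec_norm u \<le> cvec_norm (B *\<^sub>v u)"
    let ?a = "cvec_norm u" and ?b = "cvec_norm (B *\<^sub>v u)" and ?c = "cvec_norm (B *\<^sub>v (B *\<^sub>v u))"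
    show "q * ?b \<le> ?c"
    proof (cases "?b = 0")
      case False
      then have b: "0 < ?b" using cvec_norm_nonneg[of "B *\<^sub>v u"] by linarith
      have "q * ?b\<^sup>2 \<le> q * (?a * ?c)" using convex[OF u] q by (intro mult_left_mono) auto
      also have "\<dots> = (q * ?a) * ?c" by simp
      also have "\<dots> \<le> ?b * ?c" using le by (intro mult_right_mono) auto
      finally have "?b * (q * ?b) \<le> ?b * ?c" by (simp add: power2_eq_square mult_ac)
      then show ?thesis using b by simp
    qed simp
  qed (use q w in auto)
  obtain k where "(\<Sum>i<n. \<Sum>j<n. c * cmod (?w $ j)) / cvec_norm ?w < q ^ k"
    using real_arch_pow[OF q] by blast
  then have "(\<Sum>i<n. \<Sum>j<n. c * cmod (?w $ j)) < q ^ k * cvec_norm ?w"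
    using w_pos by (simp add: divide_less_eq)
  also have "\<dots> \<le> (\<Sum>i<n. \<Sum>j<n. c * cmod (?w $ j))"
    using growth[of k] norm_bound_cvec_norm_le[OF pow_carrier_mat[OF B] w c[of k]] by simp
  finally show False by simp
qed

section \<open>The mpEDMD matrix\<close>

text \<open>The adjoint of an inverse of a self-adjoint matrix is again an inverse, and inverses are
  unique. This lets the adjoint of \<open>R * mat_adjoint A * R\<close> be computed as
  \<open>R * A * R\<close>.\<close>

lemma hermitian_inverse_hermitian:
  assumes S: "(S :: complex mat) \<in> carrier_mat n n" "mat_adjoint S = S"
    and R: "R \<in> carrier_mat n n" "S * R = 1\<^sub>m n" "R * S = 1\<^sub>m n"
  shows "mat_adjoint R = R"
proof -
  let ?R = "mat_adjoint R"
  have R': "?R \<in> carrier_mat n n" using R by simp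
  have "mat_adjoint (1\<^sub>m n :: complex mat) = 1\<^sub>m n"
    by (intro eq_matI) (auto simp: mat_adjoint_index[of _ n n])
  then have RS: "?R * S = 1\<^sub>m n" using mat_adjoint_mult[OF S(1) R(1)] R(2) S(2) by simp
  have "?R = ?R * (S * R)" unfolding R(2) by (rule right_mult_one_mat[OF R', symmetric])
  also have "\<dots> = (?R * S) * R" using R' S(1) R(1) by (simp add: assoc_mult_mat[of _ n n _ n _ n])
  also have "\<dots> = R" using RS R(1) by simp
  finally show ?thesis .
qed

text \<open>The finite-dimensional core, for one data set. Both conditions on \<open>A\<close> are
  tested against \<open>d\<close> in the norm induced by \<open>G\<close>: this is the form that
  convergence of matrix entries supplies, and substituting vectors R v turns that norm into the
  Euclidean one. Then \<open>bound\<close> controls all singular values, while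
  \<open>residual\<close> makes \<open>S *\<^sub>v b\<close> an approximate eigenvector.\<close>

lemma mpedmd_eigenvalue_near:
  assumes G: "G \<in> carrier_mat n n" and A: "A \<in> carrier_mat n n" and K: "is_mpedmd_mat n G A K"
    and t: "0 < t" "t \<le> 1" and z: "cmod z = 1"
    and bound: "\<And>c d. c \<in> carrier_vec n \<Longrightarrow> d \<in> carrier_vec n \<Longrightarrow>
      cmod ((A *\<^sub>v c) \<bullet>c d)
        \<le> (1 + t) * sqrt (Re ((G *\<^sub>v c) \<bullet>c c)) * sqrt (Re ((G *\<^sub>v d) \<bullet>c d))"
    and b: "b \<in> carrier_vec n" "0 < Re ((G *\<^sub>v b) \<bullet>c b)"
    and residual: "\<And>d. d \<in> carrier_vec n \<Longrightarrow>
      cmod ((A *\<^sub>v b) \<bullet>c d - z * ((G *\<^sub>v b) \<bullet>c d))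
        \<le> t * sqrt (Re ((G *\<^sub>v b) \<bullet>c b)) * sqrt (Re ((G *\<^sub>v d) \<bullet>c d))"
  shows "infdist z (spectrum K) \<le> 4 * sqrt t"
proof -
  obtain S R U1 Sg U2 s where S: "S \<in> carrier_mat n n" "mat_adjoint S = S" "S * S = G"
    and R: "R \<in> carrier_mat n n" "S * R = 1\<^sub>m n" "R * S = 1\<^sub>m n"
    and U1: "unitary_mat n U1" and U2: "unitary_mat n U2"
    and s: "\<And>i. i < n \<Longrightarrow> 0 \<le> s i" and Sg_eq: "Sg = mat_diag n (\<lambda>i. complex_of_real (s i))"
    and svd: "R * mat_adjoint A * R = U1 * Sg * mat_adjoint U2"
    and K_eq: "K = R * U2 * mat_adjoint U1 * S"
    using K unfolding is_mpedmd_mat_def is_psd_sqrt_def is_inverse_mat_def is_svd_def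
      pos_semidef_mat_def inverts_mat_def by fastforce
  note R_adj = hermitian_inverse_hermitian[OF S(1,2) R]
  note U1' = unitary_matD[OF U1] and U2' = unitary_matD[OF U2]
  note mv = mult_mat_vec_carrier[of _ n n]
  note assoc = assoc_mult_mat_vec[of _ n n _ n]
  have Sg: "Sg \<in> carrier_mat n n" by (simp add: Sg_eq)
  have Sg_adj: "mat_adjoint Sg = Sg"
    using Sg by (intro eq_matI) (auto simp: mat_adjoint_index[of _ n n] Sg_eq mat_diag_def)
  have Sg_v: "(Sg *\<^sub>v v) $ i = s i * v $ i" if "v \<in> carrier_vec n" "i < n" for v i
    using that by (simp add: Sg_eq mat_diag_def scalar_prod_def if_distrib[of "\<lambda>x. x * _"] cong: if_cong)
  have SR: "S *\<^sub>v (R *\<^sub>v v) = v" if "v \<in> carrier_vec n" for v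
    using that S R by (simp flip: assoc)
  have RS: "R *\<^sub>v (S *\<^sub>v v) = v" if "v \<in> carrier_vec n" for v
    using that S R by (simp flip: assoc)
  have G_form: "(G *\<^sub>v v) \<bullet>c w = (S *\<^sub>v v) \<bullet>c (S *\<^sub>v w)"
    if "v \<in> carrier_vec n" "w \<in> carrier_vec n" for v w
    using that S cscalar_prod_mat_adjoint[OF S(1) mv[OF S(1) that(1)] that(2)]
    by (simp flip: S(3))
  have G_norm: "sqrt (Re ((G *\<^sub>v v) \<bullet>c v)) = cvec_norm (S *\<^sub>v v)" if "v \<in> carrier_vec n" for v
    using G_form[OF that that] cvec_norm_power2[of "S *\<^sub>v v"] by (simp flip: cvec_norm_power2)
  have RAR: "R *\<^sub>v (A *\<^sub>v (R *\<^sub>v v)) = U2 *\<^sub>v (Sg *\<^sub>v (mat_adjoint U1 *\<^sub>v v))"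
    if v: "v \<in> carrier_vec n" for v
  proof -
    have "mat_adjoint (R * mat_adjoint A * R) = R * (A * R)"
      using R A by (simp add: mat_adjoint_mult[of _ n n _ n] R_adj mat_adjoint_adjoint[of A n n])
    moreover have "mat_adjoint (U1 * Sg * mat_adjoint U2) = U2 * (Sg * mat_adjoint U1)"
      using U1' U2' Sg by (simp add: mat_adjoint_mult[of _ n n _ n] Sg_adj mat_adjoint_adjoint[of U2 n n])
    ultimately have "R * (A * R) = U2 * (Sg * mat_adjoint U1)" using svd by simp
    then have "(R * (A * R)) *\<^sub>v v = (U2 * (Sg * mat_adjoint U1)) *\<^sub>v v" by simp
    then show ?thesis
      using v R A U1' U2' Sg by (simp add: assoc mult_carrier_mat[of _ n n _ n])
  qed
  have form_R: "(A *\<^sub>v (R *\<^sub>v v)) \<bullet>c (R *\<^sub>v w) = (R *\<^sub>v (A *\<^sub>v (R *\<^sub>v v))) \<bullet>c w"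
    if "v \<in> carrier_vec n" "w \<in> carrier_vec n" for v w
    using cscalar_prod_mat_adjoint[OF R(1) mv[OF A mv[OF R(1) that(1)]] that(2)] R_adj by simp

  \<comment> \<open>Inserting the i-th singular vectors, transported by \<open>R\<close>, into
    \<open>bound\<close> turns the form into \<open>s i\<close>, and both vectors then have norm
    1.\<close>
  have s_le: "s i \<le> 1 + t" if i: "i < n" for i
  proof -
    let ?e = "unit_vec n i :: complex vec"
    have e: "?e \<in> carrier_vec n" by simp
    have ue: "U1 *\<^sub>v ?e \<in> carrier_vec n" "U2 *\<^sub>v ?e \<in> carrier_vec n" "Sg *\<^sub>v ?e \<in> carrier_vec n"
      using U1' U2' Sg by (auto intro: mv)
    have "(A *\<^sub>v (R *\<^sub>v (U1 *\<^sub>v ?e))) \<bullet>c (R *\<^sub>v (U2 *\<^sub>v ?e))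
        = (U2 *\<^sub>v (Sg *\<^sub>v (mat_adjoint U1 *\<^sub>v (U1 *\<^sub>v ?e)))) \<bullet>c (U2 *\<^sub>v ?e)"
      using ue by (simp only: form_R RAR)
    also have "mat_adjoint U1 *\<^sub>v (U1 *\<^sub>v ?e) = ?e"
      using U1' e by (simp flip: assoc)
    also have "(U2 *\<^sub>v (Sg *\<^sub>v ?e)) \<bullet>c (U2 *\<^sub>v ?e) = (Sg *\<^sub>v ?e) \<bullet>c (mat_adjoint U2 *\<^sub>v (U2 *\<^sub>v ?e))"
      using U2' ue by (intro cscalar_prod_mat_adjoint) auto
    also have "mat_adjoint U2 *\<^sub>v (U2 *\<^sub>v ?e) = ?e"
      using U2' e by (simp flip: assoc)
    also have "(Sg *\<^sub>v ?e) \<bullet>c ?e = s i"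
    proof -
      have "conjugate ?e = ?e" by (intro eq_vecI) (auto simp: unit_vec_def)
      then show ?thesis using Sg_v[OF e i] scalar_prod_right_unit[OF i] ue(3) i by simp
    qed
    finally have "cmod (complex_of_real (s i)) \<le> (1 + t) * cvec_norm (S *\<^sub>v (R *\<^sub>v (U1 *\<^sub>v ?e)))
        * cvec_norm (S *\<^sub>v (R *\<^sub>v (U2 *\<^sub>v ?e)))"
      using bound[of "R *\<^sub>v (U1 *\<^sub>v ?e)" "R *\<^sub>v (U2 *\<^sub>v ?e)"] ue mv[OF R(1)] by (simp add: G_norm)
    also have "\<dots> = 1 + t"
      using ue i U1 U2 e by (simp add: SR unitary_mat_cvec_norm cvec_norm_unit_vec)
    finally show ?thesis using s[OF i] by simp
  qed

  define u where "u = S *\<^sub>v b"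
  \<comment> \<open>Coordinates of \<open>u\<close> in which the positive factor
    \<open>U1 * Sg * mat_adjoint U1\<close> is the diagonal matrix \<open>Sg\<close>.\<close>
  define x where "x = mat_adjoint U1 *\<^sub>v u"
  have u: "u \<in> carrier_vec n" using S b by (auto simp: u_def intro: mv)
  have x: "x \<in> carrier_vec n" using U1' u by (auto simp: x_def intro: mv)
  have x_norm: "cvec_norm x = cvec_norm u"
    unfolding x_def by (rule unitary_mat_cvec_norm[OF unitary_mat_adjoint[OF U1] u])
  have Sx: "Sg *\<^sub>v x \<in> carrier_vec n" using Sg x by (rule mv)
  have Ub: "R *\<^sub>v u = b" using b by (simp add: u_def RS)
  have u_pos: "0 < cvec_norm u" unfolding u_def using real_sqrt_gt_zero[OF b(2)] G_norm[OF b(1)] by simp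

  let ?e = "U2 *\<^sub>v (Sg *\<^sub>v x) - z \<cdot>\<^sub>v u"
  have USx: "U2 *\<^sub>v (Sg *\<^sub>v x) \<in> carrier_vec n" using U2' Sx by (auto intro: mv)
  have e: "?e \<in> carrier_vec n" using USx u by simp
  \<comment> \<open>Testing \<open>residual\<close> with d = R ?e produces the squared norm of
    \<open>?e\<close>, and one factor cancels.\<close>
  have e_le: "cvec_norm ?e \<le> t * cvec_norm u"
  proof -
    have eq: "(A *\<^sub>v b) \<bullet>c (R *\<^sub>v ?e) - z * ((G *\<^sub>v b) \<bullet>c (R *\<^sub>v ?e)) = ?e \<bullet>c ?e"
    proof -
      have "(A *\<^sub>v b) \<bullet>c (R *\<^sub>v ?e) = (U2 *\<^sub>v (Sg *\<^sub>v x)) \<bullet>c ?e"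
        using form_R[OF u e] RAR[OF u] by (simp add: Ub x_def)
      moreover have "(G *\<^sub>v b) \<bullet>c (R *\<^sub>v ?e) = u \<bullet>c ?e"
        using G_form[OF b(1) mv[OF R(1) e]] SR[OF e] by (simp add: u_def)
      moreover have "?e \<bullet>c ?e = (U2 *\<^sub>v (Sg *\<^sub>v x)) \<bullet>c ?e - (z \<cdot>\<^sub>v u) \<bullet>c ?e"
        using USx u e by (intro minus_scalar_prod_distrib[of _ n]) auto
      moreover have "(z \<cdot>\<^sub>v u) \<bullet>c ?e = z * (u \<bullet>c ?e)"
        using u e by (intro smult_scalar_prod_distrib) auto
      ultimately show ?thesis by simp
    qed
    have "cmod (?e \<bullet>c ?e) \<le> t * cvec_norm u * cvec_norm ?e"
      using residual[OF mv[OF R(1) e]]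
      unfolding eq G_norm[OF b(1)] G_norm[OF mv[OF R(1) e]] SR[OF e] u_def[symmetric] .
    then have "cvec_norm ?e * cvec_norm ?e \<le> (t * cvec_norm u) * cvec_norm ?e"
      by (simp add: cscalar_prod_self norm_mult power2_eq_square)
    then show ?thesis
      using t u_pos cvec_norm_nonneg[of ?e] by (cases "cvec_norm ?e = 0") auto
  qed

  have "cvec_norm u \<le> cvec_norm (Sg *\<^sub>v x) + t * cvec_norm u"
  proof -
    have "z \<cdot>\<^sub>v u = U2 *\<^sub>v (Sg *\<^sub>v x) + (- 1) \<cdot>\<^sub>v ?e" using USx u by (intro eq_vecI) auto
    then have "cvec_norm (z \<cdot>\<^sub>v u) \<le> cvec_norm (U2 *\<^sub>v (Sg *\<^sub>v x)) + cvec_norm ((- 1) \<cdot>\<^sub>v ?e)"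
      using cvec_norm_triangle[OF USx, of "(- 1) \<cdot>\<^sub>v ?e"] e by simp
    then show ?thesis using e_le z by (simp add: cvec_norm_smult unitary_mat_cvec_norm[OF U2 Sx])
  qed
  then have "(1 - t) * cvec_norm u \<le> cvec_norm (Sg *\<^sub>v x)" by (simp add: left_diff_distrib)
  then have "((1 - t) * cvec_norm u)\<^sup>2 \<le> (cvec_norm (Sg *\<^sub>v x))\<^sup>2"
    by (rule power_mono) (use t in simp)
  \<comment> \<open>Coordinatewise (1 - s)^2 + s^2 = 1 + 2 s (s - 1), and s (s - 1) is at most t (1
    + t) by \<open>s_le\<close>. A single \<open>s i\<close> may be far below 1; the lower bound on
    the norm of Sg x makes the sum small.\<close>
  moreover have "(cvec_norm (x - Sg *\<^sub>v x))\<^sup>2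
      \<le> (1 + 2 * t * (1 + t)) * (cvec_norm x)\<^sup>2 - (cvec_norm (Sg *\<^sub>v x))\<^sup>2"
  proof -
    have sq: "(cvec_norm v)\<^sup>2 = (\<Sum>i<n. (cmod (v $ i))\<^sup>2)" if "v \<in> carrier_vec n" for v
      using that by (simp add: cvec_norm_def L2_set_def sum_nonneg)
    have "(\<Sum>i<n. (cmod ((x - Sg *\<^sub>v x) $ i))\<^sup>2)
        \<le> (\<Sum>i<n. (1 + 2 * t * (1 + t)) * (cmod (x $ i))\<^sup>2 - (cmod ((Sg *\<^sub>v x) $ i))\<^sup>2)"
    proof (rule sum_mono)
      fix i
      assume "i \<in> {..<n}"
      then have i: "i < n" by simp
      have "(1 - s i)\<^sup>2 \<le> 1 + 2 * t * (1 + t) - (s i)\<^sup>2"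
      proof -
        have "s i * (s i - 1) \<le> (1 + t) * t"
        proof (cases "s i \<le> 1")
          case True
          then have "s i * (s i - 1) \<le> 0" using s[OF i] by (intro mult_nonneg_nonpos) auto
          also have "0 \<le> (1 + t) * t" using t by simp
          finally show ?thesis .
        next
          case False
          then show ?thesis using s_le[OF i] t by (intro mult_mono) auto
        qed
        then show ?thesis by (simp add: power2_eq_square algebra_simps)
      qed
      then have "(1 - s i)\<^sup>2 * (cmod (x $ i))\<^sup>2 \<le> (1 + 2 * t * (1 + t) - (s i)\<^sup>2) * (cmod (x $ i))\<^sup>2"
        by (intro mult_right_mono) auto
      moreover have "cmod ((x - Sg *\<^sub>v x) $ i) = \<bar>1 - s i\<bar> * cmod (x $ i)"
      proof -
        have "(x - Sg *\<^sub>v x) $ i = complex_of_real (1 - s i) * x $ i"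
          using carrier_vecD[OF Sx] i Sg_v[OF x i] by (simp add: algebra_simps del: index_mult_mat_vec dim_mult_mat_vec)
        then show ?thesis by (simp only: norm_mult norm_of_real)
      qed
      moreover have "cmod ((Sg *\<^sub>v x) $ i) = s i * cmod (x $ i)"
        using Sg_v[OF x i] s[OF i] by (simp add: norm_mult del: index_mult_mat_vec)
      ultimately show "(cmod ((x - Sg *\<^sub>v x) $ i))\<^sup>2
          \<le> (1 + 2 * t * (1 + t)) * (cmod (x $ i))\<^sup>2 - (cmod ((Sg *\<^sub>v x) $ i))\<^sup>2"
        by (simp add: power_mult_distrib left_diff_distrib del: index_mult_mat_vec)
    qed
    then show ?thesis
      using x Sx by (simp add: sq sum_subtractf sum_distrib_left del: index_mult_mat_vec)
  qed
  ultimately have "(cvec_norm (x - Sg *\<^sub>v x))\<^sup>2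
      \<le> (1 + 2 * t * (1 + t)) * (cvec_norm u)\<^sup>2 - ((1 - t) * cvec_norm u)\<^sup>2"
    by (simp add: x_norm)
  also have "\<dots> = (4 * t + t\<^sup>2) * (cvec_norm u)\<^sup>2"
    by (simp add: power2_eq_square algebra_simps)
  \<comment> \<open>The constant 9 is chosen for its root: 3 * sqrt t, plus the residual t, which is
    at most sqrt t, gives 4 * sqrt t.\<close>
  also have "\<dots> \<le> 9 * t * (cvec_norm u)\<^sup>2"
  proof (rule mult_right_mono)
    have "t\<^sup>2 \<le> t" using t by (simp add: power2_eq_square mult_le_one mult_left_le_one_le)
    then show "4 * t + t\<^sup>2 \<le> 9 * t" using t by simp
  qed simp
  also have "\<dots> = (3 * sqrt t * cvec_norm u)\<^sup>2" using t by (simp add: power_mult_distrib)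
  finally have polar: "cvec_norm (x - Sg *\<^sub>v x) \<le> 3 * sqrt t * cvec_norm u"
    by (rule power2_le_imp_le) (use t u_pos in auto)

  define Q where "Q = U2 * mat_adjoint U1"
  have Q: "unitary_mat n Q"
  proof -
    have adj: "mat_adjoint Q = U1 * mat_adjoint U2"
      unfolding Q_def using U1' U2' by (simp add: mat_adjoint_mult[of _ n n _ n] mat_adjoint_adjoint[of U1 n n])
    have c: "Q \<in> carrier_mat n n" unfolding Q_def using U1' U2' by (auto intro: mult_carrier_mat)
    have "mat_adjoint Q * Q = U1 * (mat_adjoint U2 * U2) * mat_adjoint U1"
      unfolding adj unfolding Q_def using U1'(1,2) U2'(1,2) by (simp add: assoc_mult_mat[of _ n n _ n _ n] mult_carrier_mat[of _ n n _ n])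
    also have "\<dots> = 1\<^sub>m n" using U1' U2' by simp
    finally have 1: "mat_adjoint Q * Q = 1\<^sub>m n" .
    have "Q * mat_adjoint Q = U2 * (mat_adjoint U1 * U1) * mat_adjoint U2"
      unfolding adj unfolding Q_def using U1'(1,2) U2'(1,2) by (simp add: assoc_mult_mat[of _ n n _ n _ n] mult_carrier_mat[of _ n n _ n])
    also have "\<dots> = 1\<^sub>m n" using U1' U2' by simp
    finally show ?thesis using 1 c by (simp add: unitary_mat_def)
  qed
  have Qv: "Q *\<^sub>v v = U2 *\<^sub>v (mat_adjoint U1 *\<^sub>v v)" if "v \<in> carrier_vec n" for v
    unfolding Q_def by (rule assoc_mult_mat_vec[OF U2'(1) U1'(2) that])
  have "cvec_norm (Q *\<^sub>v u - z \<cdot>\<^sub>v u) \<le> cvec_norm (U2 *\<^sub>v (x - Sg *\<^sub>v x)) + cvec_norm ?e"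
  proof -
    have Ux: "U2 *\<^sub>v x \<in> carrier_vec n" using U2' x by (auto intro: mv)
    have "U2 *\<^sub>v (x - Sg *\<^sub>v x) = U2 *\<^sub>v x - U2 *\<^sub>v (Sg *\<^sub>v x)"
      using U2' x Sx by (intro mult_minus_distrib_mat_vec) auto
    then have "Q *\<^sub>v u - z \<cdot>\<^sub>v u = U2 *\<^sub>v (x - Sg *\<^sub>v x) + ?e"
      using Qv[OF u] Ux USx u
      by (intro eq_vecI) (simp_all add: x_def[symmetric] carrier_vecD del: index_mult_mat_vec dim_mult_mat_vec)
    then show ?thesis
      using cvec_norm_triangle[OF mv[OF U2'(1)] e, of "x - Sg *\<^sub>v x"] x Sx by simp
  qed
  also have "\<dots> \<le> 3 * sqrt t * cvec_norm u + t * cvec_norm u"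
    using polar e_le x Sx by (simp add: unitary_mat_cvec_norm[OF U2])
  also have "\<dots> \<le> 4 * sqrt t * cvec_norm u"
  proof -
    have "t * t \<le> t" using t by (simp add: mult_left_le_one_le)
    then have "t \<le> sqrt t" using t by (simp add: real_le_rsqrt power2_eq_square)
    then have "t * cvec_norm u \<le> sqrt t * cvec_norm u" by (intro mult_right_mono) auto
    then show ?thesis by (simp add: algebra_simps)
  qed
  finally have Q_near: "cvec_norm (Q *\<^sub>v u - z \<cdot>\<^sub>v u) \<le> 4 * sqrt t * cvec_norm u" .
  have "u \<noteq> 0\<^sub>v n" using u_pos cvec_norm_eq_0[OF u] by auto
  then obtain \<mu> where \<mu>: "eigenvalue Q \<mu>" "cmod (\<mu> - z) * cvec_norm u \<le> cvec_norm (Q *\<^sub>v u - z \<cdot>\<^sub>v u)"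
    using unitary_mat_eigenvalue_near[OF Q z u] by blast
  have "cmod (\<mu> - z) \<le> 4 * sqrt t"
    using order_trans[OF \<mu>(2) Q_near] u_pos by simp
  \<comment> \<open>\<open>K\<close> is similar to \<open>Q\<close> through \<open>S\<close>, so an
    eigenvector \<open>v\<close> of \<open>Q\<close> becomes R v. Membership gives the bound its
    content, as \<open>infdist\<close> to an empty set is 0 by convention.\<close>
  moreover have "\<mu> \<in> spectrum K"
  proof -
    note Q' = unitary_matD(1)[OF Q]
    obtain v where v: "v \<in> carrier_vec n" "v \<noteq> 0\<^sub>v n" "Q *\<^sub>v v = \<mu> \<cdot>\<^sub>v v"
      using \<mu>(1) Q' by (auto simp: eigenvalue_def eigenvector_def)
    have K_RQS: "K = R * (Q * S)" unfolding K_eq Q_def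
      using R S U1' U2' by (simp add: assoc_mult_mat[of _ n n _ n _ n] mult_carrier_mat[of _ n n _ n])
    have Kc: "K \<in> carrier_mat n n" unfolding K_RQS using R S Q' by (auto intro: mult_carrier_mat)
    have Rv: "R *\<^sub>v v \<in> carrier_vec n" using R v by (auto intro: mv)
    have "K *\<^sub>v (R *\<^sub>v v) = R *\<^sub>v (Q *\<^sub>v (S *\<^sub>v (R *\<^sub>v v)))"
      unfolding K_RQS using R S Q' Rv by (simp add: assoc mult_carrier_mat[of _ n n _ n])
    also have "\<dots> = \<mu> \<cdot>\<^sub>v (R *\<^sub>v v)"
      using v R by (simp add: SR mult_mat_vec[of _ n n])
    finally have "K *\<^sub>v (R *\<^sub>v v) = \<mu> \<cdot>\<^sub>v (R *\<^sub>v v)" .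
    moreover have "R *\<^sub>v v \<noteq> 0\<^sub>v n"
    proof
      assume "R *\<^sub>v v = 0\<^sub>v n"
      then have "v = S *\<^sub>v 0\<^sub>v n" using SR[OF v(1)] by simp
      then show False using v(2) S by auto
    qed
    ultimately show ?thesis using Rv Kc by (auto simp: spectrum_def eigenvalue_def eigenvector_def)
  qed
  ultimately show ?thesis
    using infdist_le[of \<mu> "spectrum K" z] by (simp add: dist_norm norm_minus_commute)
qed

section \<open>Convergence of the quadrature forms\<close>

text \<open>Entries and coefficients are plain functions of indices, so that sampled matrices, Gram
  arrays of inner products and their differences are treated alike, without carrier
  conditions.\<close>

definition sesq_form :: "nat \<Rightarrow> (nat \<Rightarrow> nat \<Rightarrow> complex) \<Rightarrow> (nat \<Rightarrow> complex) \<Rightarrow> (nat \<Rightarrow> complex) \<Rightarrow> complex"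
  where "sesq_form n X c d = (\<Sum>j<n. \<Sum>k<n. X j k * c k * cnj (d j))"

lemma sesq_form_diff:
  "sesq_form n (\<lambda>j k. X j k - Y j k) c d = sesq_form n X c d - sesq_form n Y c d"
  by (simp add: sesq_form_def left_diff_distrib sum_subtractf)

lemma sesq_form_scale: "sesq_form n (\<lambda>j k. z * X j k) c d = z * sesq_form n X c d"
  by (simp add: sesq_form_def sum_distrib_left mult.assoc)

lemma sesq_form_mat:
  assumes "A \<in> carrier_mat n n" "c \<in> carrier_vec n" "d \<in> carrier_vec n"
  shows "(A *\<^sub>v c) \<bullet>c d = sesq_form n (\<lambda>j k. A $$ (j, k)) (\<lambda>k. c $ k) (\<lambda>j. d $ j)"
  using assms by (simp add: sesq_form_def scalar_prod_def lessThan_atLeast0 sum_distrib_right)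

lemma sesq_form_le:
  assumes "\<And>j k. j < n \<Longrightarrow> k < n \<Longrightarrow> cmod (X j k) \<le> e"
  shows "cmod (sesq_form n X c d) \<le> e * (\<Sum>k<n. cmod (c k)) * (\<Sum>j<n. cmod (d j))"
proof -
  have "cmod (sesq_form n X c d) \<le> (\<Sum>j<n. \<Sum>k<n. e * cmod (c k) * cmod (d j))"
    unfolding sesq_form_def
    by (intro sum_norm_le) (auto simp: norm_mult intro!: mult_right_mono assms)
  also have "\<dots> = (\<Sum>k<n. \<Sum>j<n. e * cmod (c k) * cmod (d j))"
    by (rule sum.swap)
  also have "\<dots> = e * (\<Sum>k<n. cmod (c k)) * (\<Sum>j<n. cmod (d j))"
    by (simp add: sum_distrib_left sum_distrib_right mult_ac)
  finally show ?thesis .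
qed

lemma sesq_form_l2_inner:
  assumes "\<And>k. k < n \<Longrightarrow> f k \<in> l2_space \<omega>" "\<And>j. j < n \<Longrightarrow> g j \<in> l2_space \<omega>"
  shows "sesq_form n (\<lambda>j k. l2_inner \<omega> (f k) (g j)) c d
    = l2_inner \<omega> (\<lambda>x. \<Sum>k<n. c k * f k x) (\<lambda>x. \<Sum>j<n. d j * g j x)"
proof -
  have "l2_inner \<omega> (\<lambda>x. \<Sum>k<n. c k * f k x) (\<lambda>x. \<Sum>j<n. d j * g j x)
      = (\<Sum>j<n. cnj (d j) * l2_inner \<omega> (\<lambda>x. \<Sum>k<n. c k * f k x) (g j))"
    using assms by (intro l2_inner_sum(2) l2_space_sum) auto
  also have "\<dots> = (\<Sum>j<n. cnj (d j) * (\<Sum>k<n. c k * l2_inner \<omega> (f k) (g j)))"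
    using assms by (intro sum.cong refl arg_cong2[where f = "(*)"] l2_inner_sum(1)) auto
  finally show ?thesis by (simp add: sesq_form_def sum_distrib_left mult_ac)
qed

text \<open>Independence makes the Gram matrix invertible, since a kernel vector would give a
  function of norm 0. Its inverse recovers the coefficients from the inner products with the
  dictionary, and these are bounded by Cauchy-Schwarz.\<close>

lemma l2_lin_indep_coeff_bound:
  assumes \<phi>: "\<And>j. j < n \<Longrightarrow> \<phi> j \<in> l2_space \<omega>" and indep: "l2_lin_indep \<omega> n \<phi>"
  obtains C where "\<And>c. (\<Sum>k<n. cmod (c k)) \<le> C * l2_norm \<omega> (\<lambda>x. \<Sum>j<n. c j * \<phi> j x)"
proof -
  define Gr where "Gr = Matrix.mat n n (\<lambda>(j, k). l2_inner \<omega> (\<phi> k) (\<phi> j))"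
  have Gr: "Gr \<in> carrier_mat n n" by (simp add: Gr_def)
  let ?h = "\<lambda>c x. \<Sum>j<n. c j * \<phi> j x"
  have h: "?h c \<in> l2_space \<omega>" for c using \<phi> by (intro l2_space_sum) auto
  have Gr_v: "(Gr *\<^sub>v v) $ j = l2_inner \<omega> (?h (\<lambda>k. v $ k)) (\<phi> j)"
    if "v \<in> carrier_vec n" "j < n" for v j
  proof -
    have "(Gr *\<^sub>v v) $ j = (\<Sum>k<n. v $ k * l2_inner \<omega> (\<phi> k) (\<phi> j))"
      using that by (simp add: Gr_def scalar_prod_def lessThan_atLeast0 mult.commute)
    also have "\<dots> = l2_inner \<omega> (?h (\<lambda>k. v $ k)) (\<phi> j)"
      using \<phi> that by (intro l2_inner_sum(1)[symmetric]) auto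
    finally show ?thesis .
  qed
  have "det Gr \<noteq> 0"
  proof
    assume "det Gr = 0"
    then obtain v where v: "v \<in> carrier_vec n" "v \<noteq> 0\<^sub>v n" "Gr *\<^sub>v v = 0\<^sub>v n"
      using det_0_iff_vec_prod_zero[OF Gr] by auto
    let ?hv = "?h (\<lambda>k. v $ k)"
    have "l2_inner \<omega> ?hv ?hv = (\<Sum>j<n. cnj (v $ j) * l2_inner \<omega> ?hv (\<phi> j))"
      using \<phi> h by (intro l2_inner_sum(2)) auto
    also have "\<dots> = 0"
      using Gr_v[OF v(1)] v(3) by (intro sum.neutral) (metis index_zero_vec(1) lessThan_iff mult_zero_right)
    finally have "l2_norm \<omega> ?hv = 0" unfolding l2_inner_self by (simp del: of_real_power)
    from l2_norm_eq_0_AE[OF h this] have "\<forall>j<n. v $ j = 0"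
      using indep unfolding l2_lin_indep_def by blast
    then show False using v(1,2) by (auto intro: eq_vecI)
  qed
  then obtain W where W: "W \<in> carrier_mat n n" "W * Gr = 1\<^sub>m n"
    using det_non_zero_imp_unit[OF Gr, of "()"] by (auto simp: Units_def ring_mat_def)
  define C where "C = (\<Sum>k<n. \<Sum>j<n. cmod (W $$ (k, j)) * l2_norm \<omega> (\<phi> j))"
  have "(\<Sum>k<n. cmod (c k)) \<le> C * l2_norm \<omega> (?h c)" for c
  proof -
    define v where "v = Matrix.vec n c"
    have v: "v \<in> carrier_vec n" "\<And>k. k < n \<Longrightarrow> v $ k = c k" by (auto simp: v_def)
    have hv: "?h (\<lambda>k. v $ k) = ?h c" using v(2) by auto
    have "cmod (c k) \<le> (\<Sum>j<n. cmod (W $$ (k, j)) * l2_norm \<omega> (\<phi> j)) * l2_norm \<omega> (?h c)"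
      if k: "k < n" for k
    proof -
      have "W *\<^sub>v (Gr *\<^sub>v v) = v" using W Gr v by (simp flip: assoc_mult_mat_vec[of _ n n _ n])
      then have "c k = (W *\<^sub>v (Gr *\<^sub>v v)) $ k" using v(2) k by simp
      also have "\<dots> = (\<Sum>j<n. W $$ (k, j) * (Gr *\<^sub>v v) $ j)"
        using W(1) Gr k by (simp add: scalar_prod_def[of _ "Gr *\<^sub>v v"] lessThan_atLeast0)
      also have "\<dots> = (\<Sum>j<n. W $$ (k, j) * l2_inner \<omega> (?h c) (\<phi> j))"
        using Gr_v[OF v(1)] hv by simp
      also have "cmod \<dots> \<le> (\<Sum>j<n. cmod (W $$ (k, j)) * (l2_norm \<omega> (?h c) * l2_norm \<omega> (\<phi> j)))"
        using \<phi> by (intro sum_norm_le) (auto simp: norm_mult intro!: mult_left_mono l2_inner_le h)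
      finally show ?thesis by (simp add: sum_distrib_left sum_distrib_right mult_ac)
    qed
    then have "(\<Sum>k<n. cmod (c k))
        \<le> (\<Sum>k<n. (\<Sum>j<n. cmod (W $$ (k, j)) * l2_norm \<omega> (\<phi> j)) * l2_norm \<omega> (?h c))"
      by (intro sum_mono) auto
    then show ?thesis by (simp add: C_def sum_distrib_right)
  qed
  then show ?thesis by (rule that)
qed

text \<open>There are finitely many entries and \<open>p\<close> dominates all coefficients, so one
  threshold for \<open>M\<close> serves all \<open>c\<close> and \<open>d\<close>. In the
  application \<open>p c\<close> is the norm of the function with coefficients
  \<open>c\<close>.\<close>

lemma sesq_form_eventually_near:
  assumes lim: "\<forall>j<n. \<forall>k<n. (\<lambda>M. X M j k) \<longlonglongrightarrow> Y j k"
    and C: "\<And>c. (\<Sum>k<n. cmod (c k)) \<le> C * p c" and p: "\<And>c. 0 \<le> p c" and e: "0 < e"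
  shows "\<forall>\<^sub>F M in sequentially. \<forall>c d.
    cmod (sesq_form n (X M) c d - sesq_form n Y c d) \<le> e * p c * p d"
proof -
  \<comment> \<open>Two coefficient sums contribute C^2; the added 1 keeps the denominator positive
    when \<open>C\<close> is 0.\<close>
  define e' where "e' = e / (C\<^sup>2 + 1)"
  have pos: "0 < C\<^sup>2 + 1" by (simp add: add_nonneg_pos)
  have e': "0 < e'" using e pos by (simp add: e'_def)
  have "\<forall>\<^sub>F M in sequentially. \<forall>j\<in>{..<n}. \<forall>k\<in>{..<n}. cmod (X M j k - Y j k) < e'"
    using lim e' by (intro eventually_ball_finite ballI) (auto simp: tendsto_iff dist_norm)
  then show ?thesis
  proof (rule eventually_mono, intro allI)
    fix M c d
    assume near: "\<forall>j\<in>{..<n}. \<forall>k\<in>{..<n}. cmod (X M j k - Y j k) < e'"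
    have "cmod (sesq_form n (X M) c d - sesq_form n Y c d)
        \<le> e' * (\<Sum>k<n. cmod (c k)) * (\<Sum>j<n. cmod (d j))"
      unfolding sesq_form_diff[symmetric] using near by (intro sesq_form_le) (auto intro: less_imp_le)
    also have "\<dots> \<le> e' * (C * p c) * (C * p d)"
      using e' order_trans[OF sum_nonneg C] by (intro mult_mono C) (auto intro!: sum_nonneg mult_nonneg_nonneg)
    also have "\<dots> = e' * C\<^sup>2 * (p c * p d)" by (simp add: power2_eq_square)
    also have "\<dots> \<le> e * (p c * p d)"
    proof (rule mult_right_mono)
      have "e' * C\<^sup>2 \<le> e' * (C\<^sup>2 + 1)" using e' by simp
      then show "e' * C\<^sup>2 \<le> e" using pos by (simp add: e'_def)
    qed (simp add: p)
    finally show "cmod (sesq_form n (X M) c d - sesq_form n Y c d) \<le> e * p c * p d"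
      by (simp add: mult.assoc)
  qed
qed

lemma sesq_form_eventually_ge:
  assumes lim: "\<forall>j<n. \<forall>k<n. (\<lambda>M. H M j k) \<longlonglongrightarrow> H' j k"
    and C: "\<And>c. (\<Sum>k<n. cmod (c k)) \<le> C * p c" and p: "\<And>c. 0 \<le> p c"
    and H': "\<And>c. Re (sesq_form n H' c c) = (p c)\<^sup>2" and q: "q < 1"
  shows "\<forall>\<^sub>F M in sequentially. \<forall>c. q * (p c)\<^sup>2 \<le> Re (sesq_form n (H M) c c)"
proof -
  have "0 < 1 - q" using q by simp
  from sesq_form_eventually_near[OF lim C p this] show ?thesis
  proof (rule eventually_mono, intro allI)
    fix M c
    assume "\<forall>c d. cmod (sesq_form n (H M) c d - sesq_form n H' c d) \<le> (1 - q) * p c * p d"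
    then have "\<bar>Re (sesq_form n (H M) c c - sesq_form n H' c c)\<bar> \<le> (1 - q) * p c * p c"
      using abs_Re_le_cmod order_trans by blast
    then show "q * (p c)\<^sup>2 \<le> Re (sesq_form n (H M) c c)"
      using H'[of c] by (simp add: power2_eq_square algebra_simps)
  qed
qed

text \<open>Moves an estimate from the limit form and norm \<open>p\<close> to the sampled form and
  norm. The quantifiers over \<open>c\<close> and \<open>d\<close> stand inside the eventuality
  because the singular vectors to be inserted later depend on \<open>M\<close>.\<close>

lemma sesq_form_eventually_le:
  assumes limH: "\<forall>j<n. \<forall>k<n. (\<lambda>M. H M j k) \<longlonglongrightarrow> H' j k"
    and limX: "\<forall>j<n. \<forall>k<n. (\<lambda>M. X M j k) \<longlonglongrightarrow> Y j k"
    and C: "\<And>c. (\<Sum>k<n. cmod (c k)) \<le> C * p c" and p: "\<And>c. 0 \<le> p c"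
    and H': "\<And>c. Re (sesq_form n H' c c) = (p c)\<^sup>2" and b: "0 \<le> b" "b < b'"
  shows "\<forall>\<^sub>F M in sequentially. \<forall>c d. cmod (sesq_form n Y c d) \<le> b * p c * p d \<longrightarrow>
    cmod (sesq_form n (X M) c d)
      \<le> b' * sqrt (Re (sesq_form n (H M) c c)) * sqrt (Re (sesq_form n (H M) d d))"
proof -
  \<comment> \<open>The gap is shared: m - b pays for the error of \<open>X\<close>, and the ratio q
    = m / b' for replacing \<open>p\<close> by the sampled norm.\<close>
  define m where "m = (b + b') / 2"
  define q where "q = m / b'"
  have m: "b < m" "m < b'" "0 < m" using b by (auto simp: m_def)
  have q: "0 < q" "q < 1" using m b by (auto simp: q_def)
  have "0 < m - b" using m by simp
  from sesq_form_eventually_near[OF limX C p this] sesq_form_eventually_ge[OF limH C p H' q(2)]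
  show ?thesis
  proof eventually_elim
    case (elim M)
    show ?case
    proof (intro allI impI)
      fix c d
      assume le: "cmod (sesq_form n Y c d) \<le> b * p c * p d"
      let ?r = "\<lambda>c. sqrt (Re (sesq_form n (H M) c c))"
      have r: "sqrt q * p c \<le> ?r c" for c
      proof (rule real_le_rsqrt)
        show "(sqrt q * p c)\<^sup>2 \<le> Re (sesq_form n (H M) c c)"
          using elim(2) q by (simp add: power_mult_distrib)
      qed
      have "cmod (sesq_form n (X M) c d)
          \<le> cmod (sesq_form n (X M) c d - sesq_form n Y c d) + cmod (sesq_form n Y c d)"
        using norm_triangle_sub add.commute by metis
      also have "\<dots> \<le> (m - b) * p c * p d + b * p c * p d"
        using elim(1) le by (intro add_mono) auto
      also have "\<dots> = b' * (q * (p c * p d))"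
        using b m by (simp add: q_def algebra_simps)
      also have "q * (p c * p d) = (sqrt q * p c) * (sqrt q * p d)"
        using q by simp
      also have "b' * \<dots> \<le> b' * (?r c * ?r d)"
      proof (intro mult_left_mono mult_mono r)
        show "0 \<le> ?r c" using r[of c] q p[of c] by (meson mult_nonneg_nonneg order_trans real_sqrt_ge_zero less_imp_le)
      qed (use q p b in auto)
      finally show "cmod (sesq_form n (X M) c d) \<le> b' * ?r c * ?r d" by (simp add: mult.assoc)
    qed
  qed
qed

text \<open>The exact constants are 1, from the isometry, and t / 2, from \<open>residual\<close>;
  the finite-dimensional estimate tolerates 1 + t and t. These margins absorb the quadrature
  error.\<close>

lemma mpedmd_eventually_eigenvalue_near:
  assumes F: "measure_preserving_map \<omega> F"
    and \<phi>: "\<And>j. j < n \<Longrightarrow> \<phi> j \<in> l2_space \<omega>" and indep: "l2_lin_indep \<omega> n \<phi>"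
    and G: "\<And>M. G M \<in> carrier_mat n n" and A: "\<And>M. A M \<in> carrier_mat n n"
    and K: "\<And>M. invertible_mat (G M) \<Longrightarrow> is_mpedmd_mat n (G M) (A M) (K M)"
    and limG: "\<And>j k. j < n \<Longrightarrow> k < n \<Longrightarrow> (\<lambda>M. G M $$ (j, k)) \<longlonglongrightarrow> l2_inner \<omega> (\<phi> k) (\<phi> j)"
    and limA: "\<And>j k. j < n \<Longrightarrow> k < n \<Longrightarrow>
      (\<lambda>M. A M $$ (j, k)) \<longlonglongrightarrow> l2_inner \<omega> (koopman F (\<phi> k)) (\<phi> j)"
    and h: "h \<in> dictionary_span n \<phi>" "0 < l2_norm \<omega> h"
    and t: "0 < t" "t \<le> 1" and z: "cmod z = 1"
    and residual: "l2_norm \<omega> (\<lambda>x. koopman F h x - z * h x) \<le> t / 2 * l2_norm \<omega> h"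
  shows "\<forall>\<^sub>F M in sequentially. infdist z (spectrum (K M)) \<le> 4 * sqrt t"
proof -
  let ?u = "\<lambda>c x. \<Sum>j<n. c j * \<phi> j x"
  define p where "p c = l2_norm \<omega> (?u c)" for c
  define H' where "H' = (\<lambda>j k. l2_inner \<omega> (\<phi> k) (\<phi> j))"
  define A' where "A' = (\<lambda>j k. l2_inner \<omega> (koopman F (\<phi> k)) (\<phi> j))"
  have u: "?u c \<in> l2_space \<omega>" for c using \<phi> by (intro l2_space_sum) auto
  obtain C where C: "\<And>c. (\<Sum>k<n. cmod (c k)) \<le> C * p c"
    using l2_lin_indep_coeff_bound[OF \<phi> indep] unfolding p_def by blast
  have p: "0 \<le> p c" for c by (simp add: p_def l2_norm_nonneg)
  have H'_form: "sesq_form n H' c d = l2_inner \<omega> (?u c) (?u d)" for c d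
    unfolding H'_def using \<phi> by (intro sesq_form_l2_inner) auto
  have A'_form: "sesq_form n A' c d = l2_inner \<omega> (koopman F (?u c)) (?u d)" for c d
  proof -
    have "sesq_form n A' c d = l2_inner \<omega> (\<lambda>x. \<Sum>k<n. c k * koopman F (\<phi> k) x) (?u d)"
      unfolding A'_def using \<phi> by (intro sesq_form_l2_inner koopman_l2_space[OF F]) auto
    then show ?thesis by (simp add: koopman_def comp_def)
  qed
  have H': "Re (sesq_form n H' c c) = (p c)\<^sup>2" for c
    by (simp add: H'_form l2_inner_self p_def del: of_real_power)
  have A'_le: "cmod (sesq_form n A' c d) \<le> 1 * p c * p d" for c d
    using l2_inner_le[OF koopman_l2_space[OF F u] u, of c d] koopman_isometry[OF F u, of c]
    by (simp add: A'_form p_def)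
  obtain b where b: "h = ?u b" using h(1) by (auto simp: dictionary_span_def)
  \<comment> \<open>The form of the Koopman operator minus \<open>z\<close> on the span; at
    \<open>b\<close> it is controlled by \<open>residual\<close> and Cauchy-Schwarz.\<close>
  define B' where "B' = (\<lambda>j k. A' j k - z * H' j k)"
  have B'_le: "cmod (sesq_form n B' b d) \<le> t / 2 * p b * p d" for d
  proof -
    note h2 = u[of b, folded b]
    note Kh = koopman_l2_space[OF F h2]
    have "sesq_form n B' b d = l2_inner \<omega> (koopman F h) (?u d) - z * l2_inner \<omega> h (?u d)"
      unfolding B'_def sesq_form_diff sesq_form_scale by (simp add: A'_form H'_form b)
    also have "\<dots> = l2_inner \<omega> (\<lambda>x. koopman F h x - z * h x) (?u d)"
    proof -
      have "l2_inner \<omega> (\<lambda>x. koopman F h x - z * h x) (?u d)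
          = (LINT x|\<omega>. koopman F h x * cnj (?u d x) - z * (h x * cnj (?u d x)))"
        unfolding l2_inner_def by (simp only: left_diff_distrib mult.assoc)
      also have "\<dots> = (LINT x|\<omega>. koopman F h x * cnj (?u d x)) - (LINT x|\<omega>. z * (h x * cnj (?u d x)))"
        by (intro Bochner_Integration.integral_diff Bochner_Integration.integrable_mult_right
            l2_inner_integrable Kh h2 u)
      finally show ?thesis by (simp add: l2_inner_def)
    qed
    also have "cmod \<dots> \<le> l2_norm \<omega> (\<lambda>x. koopman F h x - z * h x) * p d"
      unfolding p_def by (intro l2_inner_le l2_space_diff Kh l2_space_scale h2 u)
    also have "\<dots> \<le> (t / 2 * l2_norm \<omega> h) * p d"
      by (intro mult_right_mono residual p)
    finally show ?thesis by (simp add: p_def b)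
  qed
  define H where "H M = (\<lambda>j k. G M $$ (j, k))" for M
  define X where "X M = (\<lambda>j k. A M $$ (j, k))" for M
  have limH: "\<forall>j<n. \<forall>k<n. (\<lambda>M. H M j k) \<longlonglongrightarrow> H' j k"
    using limG by (simp add: H_def H'_def)
  have limX: "\<forall>j<n. \<forall>k<n. (\<lambda>M. X M j k) \<longlonglongrightarrow> A' j k"
    using limA by (simp add: X_def A'_def)
  have limB: "\<forall>j<n. \<forall>k<n. (\<lambda>M. X M j k - z * H M j k) \<longlonglongrightarrow> B' j k"
    using limX limH unfolding B'_def by (auto intro!: tendsto_intros)
  \<comment> \<open>One choice of a factor in (0, 1): positivity yields an invertible
    \<open>G M\<close> and a nonzero sampled norm of \<open>b\<close>.\<close>
  have "(1 / 2 :: real) < 1" by simp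
  note ev1 = sesq_form_eventually_ge[OF limH C p H' this]
  have "(0::real) \<le> 1" "1 < 1 + t" using t by auto
  note ev2 = sesq_form_eventually_le[OF limH limX C p H' this]
  have "0 \<le> t / 2" "t / 2 < t" using t by auto
  note ev3 = sesq_form_eventually_le[OF limH limB C p H' this]
  from ev1 ev2 ev3 show ?thesis
  proof eventually_elim
    case (elim M)
    have G_form: "(G M *\<^sub>v c) \<bullet>c d = sesq_form n (H M) (\<lambda>k. c $ k) (\<lambda>j. d $ j)"
      if "c \<in> carrier_vec n" "d \<in> carrier_vec n" for c d
      unfolding H_def by (rule sesq_form_mat[OF G that])
    have A_form: "(A M *\<^sub>v c) \<bullet>c d = sesq_form n (X M) (\<lambda>k. c $ k) (\<lambda>j. d $ j)"
      if "c \<in> carrier_vec n" "d \<in> carrier_vec n" for c d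
      unfolding X_def by (rule sesq_form_mat[OF A that])
    \<comment> \<open>A kernel vector would have \<open>p\<close> equal to 0 by the lower bound,
      hence zero coefficients by \<open>C\<close>. Invertibility is the condition under which
      \<open>K\<close> supplies the mpEDMD relation.\<close>
    have "det (G M) \<noteq> 0"
    proof
      assume "det (G M) = 0"
      then obtain v where v: "v \<in> carrier_vec n" "v \<noteq> 0\<^sub>v n" "G M *\<^sub>v v = 0\<^sub>v n"
        using det_0_iff_vec_prod_zero[OF G[of M]] by auto
      have "sesq_form n (H M) (\<lambda>k. v $ k) (\<lambda>k. v $ k) = 0"
        using G_form[OF v(1) v(1)] v by simp
      then have "p (\<lambda>k. v $ k) = 0" using elim(1)[rule_format, of "\<lambda>k. v $ k"] by simp
      then have "(\<Sum>k<n. cmod (v $ k)) \<le> 0" using C[of "\<lambda>k. v $ k"] by simp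
      then have "\<forall>k\<in>{..<n}. cmod (v $ k) = 0"
        using sum_nonneg_eq_0_iff[of "{..<n}" "\<lambda>k. cmod (v $ k)"] sum_nonneg[of "{..<n}" "\<lambda>k. cmod (v $ k)"]
        by force
      then show False using v(1,2) by (auto intro: eq_vecI)
    qed
    then obtain W where "W \<in> carrier_mat n n" "W * G M = 1\<^sub>m n" "G M * W = 1\<^sub>m n"
      using det_non_zero_imp_unit[OF G[of M], of "()"] by (auto simp: Units_def ring_mat_def)
    then have "invertible_mat (G M)"
      using G[of M] by (auto simp: invertible_mat_def inverts_mat_def)
    note K_mat = K[OF this]
    define bv where "bv = Matrix.vec n b"
    have bv: "bv \<in> carrier_vec n" by (simp add: bv_def)
    have p_cong: "p (\<lambda>k. bv $ k) = p b" unfolding p_def bv_def by simp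
    have b_form: "sesq_form n Y (\<lambda>k. bv $ k) d = sesq_form n Y b d" for Y d
      unfolding sesq_form_def bv_def by simp
    show ?case
    proof (rule mpedmd_eigenvalue_near[OF G A K_mat t z _ bv])
      fix c d :: "complex vec"
      assume c: "c \<in> carrier_vec n" and d: "d \<in> carrier_vec n"
      show "cmod ((A M *\<^sub>v c) \<bullet>c d)
          \<le> (1 + t) * sqrt (Re ((G M *\<^sub>v c) \<bullet>c c)) * sqrt (Re ((G M *\<^sub>v d) \<bullet>c d))"
        using elim(2) A'_le by (simp add: G_form A_form c d)
    next
      have "0 < 1 / 2 * (p (\<lambda>k. bv $ k))\<^sup>2" using h(2) by (simp add: p_cong) (simp add: p_def b)
      also have "\<dots> \<le> Re (sesq_form n (H M) (\<lambda>k. bv $ k) (\<lambda>k. bv $ k))" using elim(1) by blast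
      finally show "0 < Re ((G M *\<^sub>v bv) \<bullet>c bv)" by (simp add: G_form bv)
    next
      fix d :: "complex vec"
      assume d: "d \<in> carrier_vec n"
      have "cmod (sesq_form n B' (\<lambda>k. bv $ k) (\<lambda>j. d $ j)) \<le> t / 2 * p (\<lambda>k. bv $ k) * p (\<lambda>j. d $ j)"
        unfolding b_form p_cong by (rule B'_le)
      from elim(3)[rule_format, OF this]
      show "cmod ((A M *\<^sub>v bv) \<bullet>c d - z * ((G M *\<^sub>v bv) \<bullet>c d))
          \<le> t * sqrt (Re ((G M *\<^sub>v bv) \<bullet>c bv)) * sqrt (Re ((G M *\<^sub>v d) \<bullet>c d))"
        by (simp add: G_form A_form bv d sesq_form_diff sesq_form_scale)
    qed
  qed
qed

section \<open>The approximate point spectrum\<close>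

lemma edmd_carrier:
  "edmd_G N M \<phi> x w \<in> carrier_mat N N" "edmd_A N M \<phi> x y w \<in> carrier_mat N N"
proof -
  have F: "feature_mat N M \<phi> v \<in> carrier_mat M N" for v by (simp add: feature_mat_def)
  have W: "weight_mat M w \<in> carrier_mat M M" by (simp add: weight_mat_def)
  show "edmd_G N M \<phi> x w \<in> carrier_mat N N" "edmd_A N M \<phi> x y w \<in> carrier_mat N N"
    unfolding edmd_G_def edmd_A_def
    by (intro mult_carrier_mat[of _ N M _ N] mult_carrier_mat[of _ N M _ M] mat_adjoint_carrier F W)+
qed

text \<open>Compactness of the closure provides the finite subcover, while the centres stay in
  \<open>S\<close>, where approximate eigenfunctions exist.\<close>

lemma bounded_set_finite_net:
  fixes S :: "complex set"
  assumes "bounded S" "0 < e"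
  obtains T where "finite T" "T \<subseteq> S" "\<And>z. z \<in> S \<Longrightarrow> \<exists>w\<in>T. dist z w < e"
proof -
  have "compact (closure S)" using assms(1) by (simp add: compact_closure)
  moreover have "closure S \<subseteq> (\<Union>w\<in>S. ball w e)"
  proof
    fix z
    assume "z \<in> closure S"
    then obtain w where "w \<in> S" "dist w z < e"
      using closure_approachable assms(2) by blast
    then show "z \<in> (\<Union>w\<in>S. ball w e)" by auto
  qed
  ultimately obtain T where T: "T \<subseteq> S" "finite T" "closure S \<subseteq> (\<Union>w\<in>T. ball w e)"
    using compactE_image[of "closure S" S "\<lambda>w. ball w e"] open_ball by metis
  show ?thesis
  proof (rule that[OF T(2,1)])
    fix z
    assume "z \<in> S"
    then have "z \<in> (\<Union>w\<in>T. ball w e)" using T(3) closure_subset by blast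
    then show "\<exists>w\<in>T. dist z w < e" by (auto simp: dist_commute)
  qed
qed

text \<open>One approximate eigenfunction, fixed before \<open>N\<close>, is approximated by the
  span. Since the Koopman operator minus \<open>z\<close> has norm at most 2, the residual of the
  approximant is at most t/8 + 2 * t/8 = 3t/8, and its norm is at least 7/8; 3/8 is below half of
  7/8.\<close>

lemma eventually_dictionary_approx_eigenfunction:
  assumes F: "measure_preserving_map \<omega> F"
    and dictionary: "\<And>N j. j < N \<Longrightarrow> \<psi> N j \<in> l2_space \<omega>"
    and dense: "\<And>h. h \<in> l2_space \<omega> \<Longrightarrow>
        (\<lambda>N. l2_dist \<omega> h (dictionary_span N (\<psi> N))) \<longlonglongrightarrow> 0"
    and z: "z \<in> approx_point_spectrum \<omega> (koopman F)" and t: "0 < t" "t \<le> 1"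
  shows "\<forall>\<^sub>F N in sequentially. \<exists>h \<in> dictionary_span N (\<psi> N). 0 < l2_norm \<omega> h \<and>
    l2_norm \<omega> (\<lambda>x. koopman F h x - z * h x) \<le> t / 2 * l2_norm \<omega> h"
proof -
  obtain g where g: "\<And>n. g n \<in> l2_space \<omega>" "\<And>n. l2_norm \<omega> (g n) = 1"
    and lim: "(\<lambda>n. l2_norm \<omega> (\<lambda>x. koopman F (g n) x - z * g n x)) \<longlonglongrightarrow> 0"
    using z by (auto simp: approx_point_spectrum_def)
  have "0 < t / 8" using t by simp
  then obtain m where m: "l2_norm \<omega> (\<lambda>x. koopman F (g m) x - z * g m x) < t / 8"
    using order_tendstoD(2)[OF lim, of "t / 8"] eventually_happens'[OF sequentially_bot] by blast
  let ?g = "g m"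
  have z1: "cmod z = 1" using koopman_approx_point_spectrum_cmod[OF F z] .
  have "\<forall>\<^sub>F N in sequentially. l2_dist \<omega> ?g (dictionary_span N (\<psi> N)) < t / 8"
    using order_tendstoD(2)[OF dense[OF g(1)], of "t / 8"] t by simp
  then show ?thesis
  proof (rule eventually_mono)
    fix N
    assume lt: "l2_dist \<omega> ?g (dictionary_span N (\<psi> N)) < t / 8"
    have ne: "dictionary_span N (\<psi> N) \<noteq> {}" by (auto simp: dictionary_span_def)
    have bdd: "bdd_below ((\<lambda>f. l2_norm \<omega> (\<lambda>x. ?g x - f x)) ` dictionary_span N (\<psi> N))"
      by (intro bdd_belowI[of _ 0]) (auto simp: l2_norm_nonneg)
    obtain h where h: "h \<in> dictionary_span N (\<psi> N)" "l2_norm \<omega> (\<lambda>x. ?g x - h x) < t / 8"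
      using cINF_less_iff[THEN iffD1, OF ne bdd lt[unfolded l2_dist_def]] by blast
    have hl: "h \<in> l2_space \<omega>"
      using h(1) dictionary by (auto simp: dictionary_span_def intro!: l2_space_sum)
    let ?d = "\<lambda>x. h x - ?g x"
    have d: "?d \<in> l2_space \<omega>" "l2_norm \<omega> ?d < t / 8"
      using l2_space_diff[OF hl g(1)] h(2) l2_norm_minus[of \<omega> ?g h] by auto
    have "1 \<le> l2_norm \<omega> h + t / 8"
      using l2_norm_triangle[OF hl l2_space_diff[OF g(1)[of m] hl]] h(2) g(2)[of m] by simp
    then have h_norm: "7 / 8 \<le> l2_norm \<omega> h" using t by simp
    let ?r = "\<lambda>f x. koopman F f x - z * f x"
    have "?r h = (\<lambda>x. ?r ?g x + ?r ?d x)"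
      by (simp add: koopman_def algebra_simps)
    then have "l2_norm \<omega> (?r h) \<le> l2_norm \<omega> (?r ?g) + l2_norm \<omega> (?r ?d)"
      using l2_norm_triangle[of "?r ?g" \<omega> "?r ?d"] d g(1)
      by (simp add: l2_space_diff l2_space_scale koopman_l2_space[OF F])
    also have "l2_norm \<omega> (?r ?d) \<le> l2_norm \<omega> (koopman F ?d) + l2_norm \<omega> (\<lambda>x. - z * ?d x)"
      using l2_norm_triangle[OF koopman_l2_space[OF F d(1)] l2_space_scale[OF d(1), of "- z"]] by simp
    also have "\<dots> \<le> t / 8 + t / 8"
      using d(2) z1 by (simp only: koopman_isometry[OF F d(1)] l2_norm_scale norm_minus_cancel)
    finally have "l2_norm \<omega> (?r h) \<le> 3 * t / 8" using m by simp
    also have "\<dots> \<le> t / 2 * (7 / 8)" using t by simp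
    also have "\<dots> \<le> t / 2 * l2_norm \<omega> h" using h_norm t by (intro mult_left_mono) auto
    finally show "\<exists>h \<in> dictionary_span N (\<psi> N). 0 < l2_norm \<omega> h \<and>
        l2_norm \<omega> (?r h) \<le> t / 2 * l2_norm \<omega> h"
      using h(1) h_norm by (intro bexI[of _ h]) auto
  qed
qed

text \<open>A sampled Gram matrix has rank at most \<open>M\<close>, so for M < N it is singular and
  \<open>K N M\<close> is unconstrained; the limsup ignores this, as invertibility holds for all
  large \<open>M\<close>. In \<open>ennreal\<close> a supremum over an empty spectrum is 0 and every
  limsup exists.\<close>

theorem theorem5p8:
  fixes \<omega> :: "(real ^ 'd) measure"
    and F :: "real ^ 'd \<Rightarrow> real ^ 'd"
    and \<psi> :: "nat \<Rightarrow> nat \<Rightarrow> real ^ 'd \<Rightarrow> complex"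
    and x :: "nat \<Rightarrow> nat \<Rightarrow> real ^ 'd"
    and y :: "nat \<Rightarrow> nat \<Rightarrow> real ^ 'd"
    and w :: "nat \<Rightarrow> nat \<Rightarrow> real"
    and K :: "nat \<Rightarrow> nat \<Rightarrow> complex mat"
  assumes F: "measure_preserving_map \<omega> F"
    and dictionary: "\<And>N j. j < N \<Longrightarrow> \<psi> N j \<in> l2_space \<omega>"
    and independent: "\<And>N. l2_lin_indep \<omega> N (\<psi> N)"
    and points: "\<And>M m. m < M \<Longrightarrow> x M m \<in> space \<omega>"
    and images: "\<And>M m. m < M \<Longrightarrow> y M m = F (x M m)"
    and weights: "\<And>M m. m < M \<Longrightarrow> 0 \<le> w M m"
    and mpEDMD: "\<And>N M. 0 < N \<Longrightarrow> invertible_mat (edmd_G N M (\<psi> N) (x M) (w M)) \<Longrightarrow>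
        is_mpedmd_mat N (edmd_G N M (\<psi> N) (x M) (w M))
          (edmd_A N M (\<psi> N) (x M) (y M) (w M)) (K N M)"
    and dense: "\<And>h. h \<in> l2_space \<omega> \<Longrightarrow>
        (\<lambda>N. l2_dist \<omega> h (dictionary_span N (\<psi> N))) \<longlonglongrightarrow> 0"
    and quadrature_G: "\<And>N j k. j < N \<Longrightarrow> k < N \<Longrightarrow>
        (\<lambda>M. edmd_G N M (\<psi> N) (x M) (w M) $$ (j, k))
          \<longlonglongrightarrow> l2_inner \<omega> (\<psi> N k) (\<psi> N j)"
    and quadrature_A: "\<And>N j k. j < N \<Longrightarrow> k < N \<Longrightarrow>
        (\<lambda>M. edmd_A N M (\<psi> N) (x M) (y M) (w M) $$ (j, k))
          \<longlonglongrightarrow> l2_inner \<omega> (koopman F (\<psi> N k)) (\<psi> N j)"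
  shows "(\<lambda>N. limsup (\<lambda>M. SUP z \<in> approx_point_spectrum \<omega> (koopman F).
            ennreal (infdist z (spectrum (K N M))))) \<longlonglongrightarrow> 0"
proof (rule order_tendstoI)
  let ?S = "approx_point_spectrum \<omega> (koopman F)"
  fix a :: ennreal
  assume "0 < a"
  \<comment> \<open>A real number strictly below \<open>a\<close>, which may be infinite; the gap
    restores strictness after the limsup.\<close>
  then obtain e where e: "0 < ennreal e" "ennreal e < a"
    using ennreal_rat_dense[OF \<open>0 < a\<close>] by blast
  then have e_pos: "0 < e" by simp
  \<comment> \<open>Half of \<open>e\<close> goes to the eigenvalue estimate, 4 * sqrt t, and half
    to the mesh of the net.\<close>
  define t where "t = min 1 ((e / 8)\<^sup>2)"
  have t: "0 < t" "t \<le> 1" using e_pos by (auto simp: t_def)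
  have t_e: "4 * sqrt t \<le> e / 2"
  proof -
    have "sqrt t \<le> sqrt ((e / 8)\<^sup>2)"
      by (rule real_sqrt_le_mono) (simp add: t_def)
    then show ?thesis using e_pos by simp
  qed
  have S_cmod: "cmod z = 1" if "z \<in> ?S" for z using koopman_approx_point_spectrum_cmod[OF F that] .
  then have "bounded ?S" by (intro boundedI[of _ 1]) auto
  moreover have "0 < e / 2" using e_pos by simp
  ultimately obtain T where T: "finite T" "T \<subseteq> ?S" "\<And>z. z \<in> ?S \<Longrightarrow> \<exists>w\<in>T. dist z w < e / 2"
    by (rule bounded_set_finite_net) blast
  have "\<forall>\<^sub>F N in sequentially. \<forall>z\<in>T. \<exists>h \<in> dictionary_span N (\<psi> N). 0 < l2_norm \<omega> h \<and>
      l2_norm \<omega> (\<lambda>x. koopman F h x - z * h x) \<le> t / 2 * l2_norm \<omega> h"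
    using T(1,2) by (intro eventually_ball_finite ballI
        eventually_dictionary_approx_eigenfunction[OF F dictionary dense _ t]) auto
  with eventually_gt_at_top[of "0::nat"]
  show "\<forall>\<^sub>F N in sequentially. limsup (\<lambda>M. SUP z \<in> ?S. ennreal (infdist z (spectrum (K N M)))) < a"
  proof eventually_elim
    case (elim N)
    have "\<forall>\<^sub>F M in sequentially. infdist z (spectrum (K N M)) \<le> 4 * sqrt t" if z: "z \<in> T" for z
    proof -
      from elim(2) z obtain h where h: "h \<in> dictionary_span N (\<psi> N)" "0 < l2_norm \<omega> h"
        "l2_norm \<omega> (\<lambda>x. koopman F h x - z * h x) \<le> t / 2 * l2_norm \<omega> h" by blast
      have "cmod z = 1" using S_cmod z T(2) by blast
      from mpedmd_eventually_eigenvalue_near[OF F dictionary independent edmd_carrier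
          mpEDMD[OF elim(1)] quadrature_G quadrature_A h(1,2) t this h(3)]
      show ?thesis .
    qed
    then have "\<forall>\<^sub>F M in sequentially. \<forall>z\<in>T. infdist z (spectrum (K N M)) \<le> 4 * sqrt t"
      using T(1) by (intro eventually_ball_finite) auto
    then have "\<forall>\<^sub>F M in sequentially. (SUP z \<in> ?S. ennreal (infdist z (spectrum (K N M)))) \<le> ennreal e"
    proof (rule eventually_mono)
      fix M
      assume net: "\<forall>z\<in>T. infdist z (spectrum (K N M)) \<le> 4 * sqrt t"
      show "(SUP z \<in> ?S. ennreal (infdist z (spectrum (K N M)))) \<le> ennreal e"
      proof (intro SUP_least ennreal_leI)
        fix z
        assume "z \<in> ?S"
        then obtain v where v: "v \<in> T" "dist z v < e / 2" using T(3) by blast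
        have "infdist z (spectrum (K N M)) \<le> infdist v (spectrum (K N M)) + dist z v"
          by (rule infdist_triangle)
        then show "infdist z (spectrum (K N M)) \<le> e" using net v t_e by fastforce
      qed
    qed
    then have "limsup (\<lambda>M. SUP z \<in> ?S. ennreal (infdist z (spectrum (K N M)))) \<le> ennreal e"
      by (rule Limsup_bounded)
    then show ?case using e(2) by (rule le_less_trans)
  qed
\<comment> \<open>The remaining half of the order criterion is vacuous: nothing in
  \<open>ennreal\<close> lies below 0.\<close>
qed simp

end
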